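(* Let $\mathbb{F}$ be an algebraically closed field and let $e\le h\le \ell$ be positive integers. Then \[ \underline{Q}(\langle e,h,\ell\rangle)=\mathrm{GR}(\langle e,h,\ell\rangle)=\begin{cases} eh-\left\lfloor \frac{(e+h-\ell)^2}{4}\right\rfloor & \text{if } e+h\ge \ell,\\ eh & \text{otherwise.}\end{cases} \] In particular, $\underline{Q}(\langle m,m,m\rangle)=\mathrm{GR}(\langle m,m,m\rangle)=\lceil \tfrac34 m^2\rceil$ for every positive integer $m$.
   Context: The matrix multiplication tensor $\langle e,h,\ell\rangle\in\mathbb{F}^{eh\times h\ell\times \ell e}$ is the tensor whose trilinear map is $\mathbb{F}^{e\times h}\times\mathbb{F}^{h\times\ell}\times\mathbb{F}^{\ell\times e}\to\mathbb{F}$, $(X,Y,Z)\mapsto \mathrm{Tr}(XYZ)$. For a tensor $T\in\mathbb{F}^{n_1\times n_2\times n_3}$ with trilinear form $T(x,y,z)=\sum_{i,j,k}T_{i,j,k}x_iy_jz_k$ and $T(x,y,\cdot)=(T(x,y,e_k))_k$, the geometric rank is $\mathrm{GR}(T)=\operatorname{codim}\{(x,y)\in\mathbb{F}^{n_1}\times\mathbb{F}^{n_2}: T(x,y,\cdot)=0\}$ (codimension of an affine variety, i.e. $n_1+n_2$ minus its dimension). For tensors $S\in\mathbb{F}^{m_1\times m_2\times m_3}$, $T\in\mathbb{F}^{n_1\times n_2\times n_3}$ and matrices $A,B,C$, set $(A,B,C)\cdot T=(\sum_{a,b,c}A_{ia}B_{jb}C_{kc}T_{a,b,c})_{i,j,k}$.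 We write $S\unlhd T$ (degeneration) if for some $e'\in\mathbb{N}$ there are tensors $S_1,\dots,S_{e'}$ over $\mathbb{F}$ and matrices $A(\varepsilon),B(\varepsilon),C(\varepsilon)$ with entries Laurent polynomials in a formal variable $\varepsilon$ such that $S+\varepsilon S_1+\dots+\varepsilon^{e'}S_{e'}=(A(\varepsilon),B(\varepsilon),C(\varepsilon))\cdot T$. $I_n$ denotes the $n\times n\times n$ diagonal tensor with ones on the diagonal. The border subrank is $\underline{Q}(T)=\max\{n\in\mathbb{N}: I_n\unlhd T\}$. *)

theory Defs
  imports
    Complex_Main
    "HOL-Library.FuncSet"
    "HOL-Library.Poly_Mapping"
    "HOL-Computational_Algebra.Polynomial"
begin

section \<open>Tensors\<close>

text \<open>
  A tensor carries its three finite index sets explicitly, since its format varies inside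
  statements. Values of \<open>entry\<close> outside the index sets carry no meaning and are never used.
\<close>

record ('i, 'j, 'k, 'a) tensor =
  idx1 :: "'i set"
  idx2 :: "'j set"
  idx3 :: "'k set"
  entry :: "'i \<Rightarrow> 'j \<Rightarrow> 'k \<Rightarrow> 'a"

definition trilinear_form ::
  "('i, 'j, 'k, 'a::comm_semiring_1) tensor \<Rightarrow> ('i \<Rightarrow> 'a) \<Rightarrow> ('j \<Rightarrow> 'a) \<Rightarrow> ('k \<Rightarrow> 'a) \<Rightarrow> 'a" where
  "trilinear_form T x y z =
     (\<Sum>i\<in>idx1 T. \<Sum>j\<in>idx2 T. \<Sum>k\<in>idx3 T. entry T i j k * x i * y j * z k)"

definition std_basis :: "'k \<Rightarrow> 'k \<Rightarrow> 'a::zero_neq_one" where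
  "std_basis k = (\<lambda>k'. if k' = k then 1 else 0)"

text \<open>
  The entries of \<open>(A, B, C) \<cdot> T\<close>; the first index of each matrix ranges over the new index set.
\<close>

definition tensor_act ::
  "('i' \<Rightarrow> 'i \<Rightarrow> 'r::comm_semiring_1) \<Rightarrow> ('j' \<Rightarrow> 'j \<Rightarrow> 'r) \<Rightarrow> ('k' \<Rightarrow> 'k \<Rightarrow> 'r) \<Rightarrow>
   ('i, 'j, 'k, 'r) tensor \<Rightarrow> 'i' \<Rightarrow> 'j' \<Rightarrow> 'k' \<Rightarrow> 'r" where
  "tensor_act A B C T i j k =
     (\<Sum>a\<in>idx1 T. \<Sum>b\<in>idx2 T. \<Sum>c\<in>idx3 T. A i a * B j b * C k c * entry T a b c)"

definition unit_tensor :: "nat \<Rightarrow> (nat, nat, nat, 'a::zero_neq_one) tensor" where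
  "unit_tensor n =
     \<lparr>idx1 = {..<n}, idx2 = {..<n}, idx3 = {..<n},
      entry = (\<lambda>i j k. if i = j \<and> j = k then 1 else 0)\<rparr>"

type_synonym 'a matmul_tensor = "(nat \<times> nat, nat \<times> nat, nat \<times> nat, 'a) tensor"

text \<open>
  The matrix multiplication tensor \<open>\<langle>e, h, l\<rangle>\<close>; the coordinates of a matrix are indexed by pairs
  (row, column). The lemma after the definition identifies its trilinear form with
  \<open>Tr (X Y Z)\<close>.
\<close>

definition matmul_tensor :: "nat \<Rightarrow> nat \<Rightarrow> nat \<Rightarrow> 'a::zero_neq_one matmul_tensor" where
  "matmul_tensor e h l =
     \<lparr>idx1 = {..<e} \<times> {..<h}, idx2 = {..<h} \<times> {..<l}, idx3 = {..<l} \<times> {..<e},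
      entry = (\<lambda>(i, j) (j', k) (k', i'). if j = j' \<and> k = k' \<and> i = i' then 1 else 0)\<rparr>"

lemma trilinear_form_matmul_tensor:
  fixes X Y Z :: "nat \<times> nat \<Rightarrow> 'a::comm_semiring_1"
  shows "trilinear_form (matmul_tensor e h l) X Y Z =
           (\<Sum>i<e. \<Sum>j<h. \<Sum>k<l. X (i, j) * Y (j, k) * Z (k, i))"
proof -
  have eq: "(if j = j' \<and> k = k' \<and> i = i' then 1 else 0) * X (i, j) * Y (j', k) * Z (k', i') =
      (if i' = i then (if k' = k then (if j' = j then X (i, j) * Y (j', k) * Z (k', i') else 0)
         else 0) else 0)" for i j j' k k' i' :: nat
    by auto
  show ?thesis
    unfolding trilinear_form_def matmul_tensor_def
    apply (simp add: sum.cartesian_product' eq cong: sum.cong_simp)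
    apply (rule sum.cong[OF refl], rule sum.cong[OF refl], subst sum.swap)
    apply (simp add: sum.delta sum.delta')
    done
qed

section \<open>Degeneration and border subrank\<close>

text \<open>
  Laurent polynomials in \<open>\<epsilon>\<close>: finitely supported coefficient families indexed by the integer
  exponents, with convolution product; \<open>c \<epsilon>^n\<close> is \<open>Poly_Mapping.single n c\<close>.
\<close>

type_synonym 'a laurent_poly = "int \<Rightarrow>\<^sub>0 'a"

definition to_laurent ::
  "('i, 'j, 'k, 'a::comm_ring_1) tensor \<Rightarrow> ('i, 'j, 'k, 'a laurent_poly) tensor" where
  "to_laurent T =
     \<lparr>idx1 = idx1 T, idx2 = idx2 T, idx3 = idx3 T,
      entry = (\<lambda>i j k. Poly_Mapping.single 0 (entry T i j k))\<rparr>"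

definition degenerates_to ::
  "('i, 'j, 'k, 'a::field) tensor \<Rightarrow> ('i', 'j', 'k', 'a) tensor \<Rightarrow> bool"
  (infix "\<unlhd>" 50) where
  "S \<unlhd> T \<longleftrightarrow>
     (\<exists>(e' :: nat) (R :: nat \<Rightarrow> 'i \<Rightarrow> 'j \<Rightarrow> 'k \<Rightarrow> 'a)
       (A :: 'i \<Rightarrow> 'i' \<Rightarrow> 'a laurent_poly)
       (B :: 'j \<Rightarrow> 'j' \<Rightarrow> 'a laurent_poly)
       (C :: 'k \<Rightarrow> 'k' \<Rightarrow> 'a laurent_poly).
       \<forall>i\<in>idx1 S. \<forall>j\<in>idx2 S. \<forall>k\<in>idx3 S.
         Poly_Mapping.single 0 (entry S i j k)
           + (\<Sum>q=1..e'. Poly_Mapping.single (int q) (R q i j k))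
         = tensor_act A B C (to_laurent T) i j k)"

definition border_subrank :: "('i, 'j, 'k, 'a::field) tensor \<Rightarrow> nat" where
  "border_subrank T = Max {n. (unit_tensor n :: (nat, nat, nat, 'a) tensor) \<unlhd> T}"

section \<open>Affine varieties and their dimension\<close>

text \<open>
  Affine space over an index set \<open>I\<close>: the functions \<open>I \<rightarrow> 'a\<close>, extended by \<open>undefined\<close>
  outside \<open>I\<close>.
\<close>

definition affine_space :: "'v set \<Rightarrow> ('v \<Rightarrow> 'a) set" where
  "affine_space I = I \<rightarrow>\<^sub>E UNIV"

text \<open>
  Multivariate polynomials are finitely supported families of coefficients indexed by
  monomials, a monomial being a finitely supported family of exponents.
\<close>

type_synonym ('v, 'a) multipoly = "('v \<Rightarrow>\<^sub>0 nat) \<Rightarrow>\<^sub>0 'a"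

definition poly_ring :: "'v set \<Rightarrow> ('v, 'a::zero) multipoly set" where
  "poly_ring I = {p. \<forall>m\<in>Poly_Mapping.keys p. Poly_Mapping.keys m \<subseteq> I}"

definition eval_poly :: "('v, 'a::comm_semiring_1) multipoly \<Rightarrow> ('v \<Rightarrow> 'a) \<Rightarrow> 'a" where
  "eval_poly p x =
     (\<Sum>m\<in>Poly_Mapping.keys p. Poly_Mapping.lookup p m * (\<Prod>v\<in>Poly_Mapping.keys m. x v ^ Poly_Mapping.lookup m v))"

definition zariski_closed :: "'v set \<Rightarrow> ('v \<Rightarrow> 'a::field) set \<Rightarrow> bool" where
  "zariski_closed I V \<longleftrightarrow>
     (\<exists>P \<subseteq> poly_ring I. V = {x \<in> affine_space I. \<forall>p\<in>P. eval_poly p x = 0})"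

definition irreducible_closed :: "'v set \<Rightarrow> ('v \<Rightarrow> 'a::field) set \<Rightarrow> bool" where
  "irreducible_closed I V \<longleftrightarrow>
     zariski_closed I V \<and> V \<noteq> {} \<and>
     (\<forall>V1 V2. zariski_closed I V1 \<longrightarrow> zariski_closed I V2 \<longrightarrow> V = V1 \<union> V2 \<longrightarrow>
        V = V1 \<or> V = V2)"

text \<open>
  The (Krull) dimension of a nonempty Zariski closed set \<open>V\<close>: the maximal \<open>d\<close> for which there
  is a chain \<open>Z 0 \<subset> Z 1 \<subset> \<dots> \<subset> Z d\<close> of irreducible closed subsets of \<open>V\<close>. For finite \<open>I\<close>
  such \<open>d\<close> are bounded by \<open>card I\<close>, so the maximum exists and the natural number subtraction
  in the codimension does not truncate.
\<close>

definition variety_dim :: "'v set \<Rightarrow> ('v \<Rightarrow> 'a::field) set \<Rightarrow> nat" where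
  "variety_dim I V =
     Max {d. \<exists>Z :: nat \<Rightarrow> ('v \<Rightarrow> 'a) set.
               (\<forall>i\<le>d. irreducible_closed I (Z i) \<and> Z i \<subseteq> V) \<and>
               (\<forall>i<d. Z i \<subset> Z (Suc i))}"

definition variety_codim :: "'v set \<Rightarrow> ('v \<Rightarrow> 'a::field) set \<Rightarrow> nat" where
  "variety_codim I V = card I - variety_dim I V"

section \<open>Geometric rank\<close>

text \<open>
  A pair \<open>(x, y)\<close> is encoded as a single point \<open>v\<close> of the affine space over the disjoint union
  of the first two index sets, with \<open>x = v \<circ> Inl\<close> and \<open>y = v \<circ> Inr\<close>.
\<close>

definition kernel_variety :: "('i, 'j, 'k, 'a::field) tensor \<Rightarrow> ('i + 'j \<Rightarrow> 'a) set" where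
  "kernel_variety T =
     {v \<in> affine_space (idx1 T <+> idx2 T).
        \<forall>k\<in>idx3 T. trilinear_form T (v \<circ> Inl) (v \<circ> Inr) (std_basis k) = 0}"

definition geometric_rank :: "('i, 'j, 'k, 'a::field) tensor \<Rightarrow> nat" where
  "geometric_rank T = variety_codim (idx1 T <+> idx2 T) (kernel_variety T)"

end

theory Submission
  imports Defs
begin

text \<open>
  Write \<open>V\<close> for the variety of pairs \<open>(X, Y)\<close> with \<open>X Y = 0\<close>, in an affine space of dimension
  \<open>N\<close>, and \<open>g\<close> for the claimed value.

  Strassen's monomial degeneration gives \<open>I_g \<unlhd> \<langle>e, h, l\<rangle>\<close>, and the closures of the images of
  coordinate subspaces under a parametrization of the pairs in \<open>V\<close> with \<open>X\<close> of rank
  \<open>r = \<lfloor>max 0 (e + h - l) / 2\<rfloor>\<close> form a chain of irreducible closed subsets of \<open>V\<close> of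
  length \<open>N - g\<close>.

  Both are optimal because \<open>I_n \<unlhd> T\<close> and a chain of length \<open>d\<close> in the kernel variety of any
  tensor \<open>T\<close> force \<open>d + n \<le> N\<close>, which is proved by counting monomials. The chain yields \<open>d\<close>
  polynomials that are algebraically independent on the variety. After substituting
  \<open>(A(\<epsilon>) u, B(\<epsilon>) v) + \<epsilon>^s w\<close> for \<open>(x, y)\<close> these and \<open>u, v\<close> are \<open>d + 2 n\<close> independent functions,
  whereas the \<open>n\<close> equations \<open>u_k v_k + \<epsilon> (\<dots>) = 0\<close> express, for all but finitely many \<open>\<epsilon>\<close>, every
  monomial of degree at most \<open>q\<close> through monomials avoiding all \<open>u_k v_k\<close>, of which there are
  \<open>O(q^(N + n))\<close>.
\<close>

section \<open>Linear systems\<close>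

text \<open>Hence the argument lives at one fixed nonzero \<epsilon>, and the limit enters only
  through the fact that a polynomial matrix equal to the identity at 0 is invertible outside a
  finite set.

  The vector w repairs a second defect: (A(\<epsilon>) u, B(\<epsilon>) v) may miss most of V, so
  that polynomials independent on V could become dependent after the substitution. With \<epsilon>^s
  w added, every point of V is reached for every choice of u and v. The price is N further
  variables, which is exactly the N of the bound.

  The value g comes from the pairs with X of rank r, which have dimension r (e + h - r) + (h - r) l
  and thus codimension e h - r (e + h - l - r). This is smallest for r near half of e + h - l, if
  that is positive, and for such r the same number counts the cells of the band of diagonals behind
  Strassen's degeneration.\<close>

text \<open>Gaussian elimination: either the equation \<open>g\<close> is void, or one pivot unknown
  \<open>p\<close> is spent on it, so the surplus of unknowns survives.\<close>

lemma homogeneous_system_nontrivial_solution: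
  fixes \<beta> :: "'e \<Rightarrow> 'g \<Rightarrow> 'a::field"
  assumes "finite G" "finite E" "card G < card E"
  shows "\<exists>c. (\<exists>x\<in>E. c x \<noteq> 0) \<and> (\<forall>g\<in>G. (\<Sum>x\<in>E. c x * \<beta> x g) = 0)"
  using assms
proof (induction G arbitrary: E \<beta> rule: finite_induct)
  case empty
  then obtain x where "x \<in> E" by fastforce
  then show ?case by (intro exI[of _ "\<lambda>_. 1"]) auto
next
  case (insert g G)
  show ?case
  proof (cases "\<forall>x\<in>E. \<beta> x g = 0")
    case True
    have "card G < card E" using insert by simp
    then obtain c where "\<exists>x\<in>E. c x \<noteq> 0" "\<forall>g\<in>G. (\<Sum>x\<in>E. c x * \<beta> x g) = 0"
      using insert.IH[OF insert.prems(1)] by blast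
    then show ?thesis using True by (intro exI[of _ c]) auto
  next
    case False
    then obtain p where p: "p \<in> E" "\<beta> p g \<noteq> 0" by blast
    define E' where "E' = E - {p}"
    have E': "finite E'" "p \<notin> E'" "E = insert p E'"
      using p insert.prems unfolding E'_def by auto
    have "card G < card E'" using insert E' by simp
    then obtain c where c: "\<exists>x\<in>E'. c x \<noteq> 0"
      "\<forall>h\<in>G. (\<Sum>x\<in>E'. c x * (\<beta> x h - \<beta> x g / \<beta> p g * \<beta> p h)) = 0"
      using insert.IH[OF E'(1), of "\<lambda>x h. \<beta> x h - \<beta> x g / \<beta> p g * \<beta> p h"] by blast
    \<comment> \<open>The value of the pivot unknown forced by the equation \<open>g\<close>;
      inserted into the other equations it produces the reduced coefficients.\<close>
    define d where "d = - (\<Sum>x\<in>E'. c x * (\<beta> x g / \<beta> p g))"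
    have "(\<Sum>x\<in>E. (c(p := d)) x * \<beta> x h) = 0" if "h \<in> insert g G" for h
    proof -
      have "(\<Sum>x\<in>E. (c(p := d)) x * \<beta> x h) = d * \<beta> p h + (\<Sum>x\<in>E'. c x * \<beta> x h)"
        unfolding E'(3) using E'(1,2) by (subst sum.insert) (auto intro!: sum.cong)
      also have "\<dots> = (\<Sum>x\<in>E'. c x * (\<beta> x h - \<beta> x g / \<beta> p g * \<beta> p h))"
        unfolding d_def by (simp add: sum_subtractf right_diff_distrib sum_distrib_right mult.assoc)
      also have "\<dots> = 0"
        using that c(2) p(2) by auto
      finally show ?thesis .
    qed
    moreover have "\<exists>x\<in>E. (c(p := d)) x \<noteq> 0"
      using c(1) E' by fastforce
    ultimately show ?thesis by blast
  qed
qed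

text \<open>
  The multipliers \<open>\<gamma>\<close> do not depend on the solution \<open>h\<close>, which will be the values of all
  monomials at a point.
\<close>

lemma perturbed_identity_eliminate:
  fixes G :: "'s \<Rightarrow> 's \<Rightarrow> 'a::field poly"
  assumes "finite S" "D \<subseteq> S"
    and "\<And>m s. m \<in> D \<Longrightarrow> s \<in> S \<Longrightarrow> poly (G m s) 0 = (if m = s then 1 else 0)"
  shows "\<exists>E. finite E \<and> (\<forall>\<epsilon>. \<epsilon> \<notin> E \<longrightarrow> (\<exists>\<gamma>. \<forall>h.
           (\<forall>m\<in>D. (\<Sum>s\<in>S. poly (G m s) \<epsilon> * h s) = 0) \<longrightarrow>
           (\<forall>m\<in>D. h m = (\<Sum>s\<in>S - D. \<gamma> m s * h s))))"
proof -
  have "finite D" using assms finite_subset by blast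
  then show ?thesis using assms
  proof (induction D arbitrary: S G rule: finite_induct)
    case empty
    then show ?case by (intro exI[of _ "{}"]) auto
  next
    case (insert d D)
    define S' where "S' = S - {d}"
    \<comment> \<open>Cross-multiplication instead of division keeps the entries polynomial, and at
      0 the reduced matrix again has the shape of an identity.\<close>
    define G' where "G' m s = G d d * G m s - G m d * G d s" for m s
    have S': "finite S'" "d \<notin> S'" "S = insert d S'"
      using insert.prems unfolding S'_def by auto
    have D: "D \<subseteq> S'" "S - insert d D = S' - D" using insert unfolding S'_def by auto
    have "poly (G' m s) 0 = (if m = s then 1 else 0)" if "m \<in> D" "s \<in> S'" for m s
      using that insert.prems(3)[of m s] insert.prems(3)[of d d] insert.prems(3)[of m d]
        insert.prems(3)[of d s] insert.hyps S' D(1) unfolding G'_def by auto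
    then obtain E where E: "finite E"
      "\<And>\<epsilon>. \<epsilon> \<notin> E \<Longrightarrow> (\<exists>\<gamma>. \<forall>h.
           (\<forall>m\<in>D. (\<Sum>s\<in>S'. poly (G' m s) \<epsilon> * h s) = 0) \<longrightarrow>
           (\<forall>m\<in>D. h m = (\<Sum>s\<in>S' - D. \<gamma> m s * h s)))"
      using insert.IH[OF S'(1) D(1), of G'] by blast
    have "poly (G d d) 0 = 1" using insert.prems S' by auto
    then have "G d d \<noteq> 0" by auto
    then have fin: "finite (E \<union> {\<epsilon>. poly (G d d) \<epsilon> = 0})"
      using E(1) poly_roots_finite by blast
    have "\<exists>\<gamma>. \<forall>h. (\<forall>m\<in>insert d D. (\<Sum>s\<in>S. poly (G m s) \<epsilon> * h s) = 0) \<longrightarrow>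
           (\<forall>m\<in>insert d D. h m = (\<Sum>s\<in>S - insert d D. \<gamma> m s * h s))"
      if \<epsilon>: "\<epsilon> \<notin> E \<union> {\<epsilon>. poly (G d d) \<epsilon> = 0}" for \<epsilon>
    proof -
      obtain \<gamma> where \<gamma>: "\<And>h. (\<forall>m\<in>D. (\<Sum>s\<in>S'. poly (G' m s) \<epsilon> * h s) = 0) \<Longrightarrow>
           (\<forall>m\<in>D. h m = (\<Sum>s\<in>S' - D. \<gamma> m s * h s))"
        using E(2)[of \<epsilon>] \<epsilon> by blast
      define g where "g m s = poly (G m s) \<epsilon>" for m s
      have g0: "g d d \<noteq> 0" using \<epsilon> unfolding g_def by auto
      \<comment> \<open>Row \<open>d\<close> is solved for \<open>h d\<close> after inserting the
        expansions of \<open>h m\<close> for \<open>m \<in> D\<close>; \<open>g d d\<close> is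
        nonzero by the choice of \<epsilon>.\<close>
      define \<gamma>' where "\<gamma>' = \<gamma>(d := (\<lambda>s. - (g d s + (\<Sum>m\<in>D. g d m * \<gamma> m s)) / g d d))"
      have "h m = (\<Sum>s\<in>S - insert d D. \<gamma>' m s * h s)"
        if h: "\<forall>m\<in>insert d D. (\<Sum>s\<in>S. g m s * h s) = 0" and m: "m \<in> insert d D" for h m
      proof -
        have row: "g m d * h d + (\<Sum>s\<in>S'. g m s * h s) = 0" if "m \<in> insert d D" for m
          using h that S' by (auto simp: sum.insert)
        have "(\<Sum>s\<in>S'. poly (G' m s) \<epsilon> * h s) = 0" if "m \<in> D" for m
        proof -
          have "(\<Sum>s\<in>S'. poly (G' m s) \<epsilon> * h s) =
              g d d * (\<Sum>s\<in>S'. g m s * h s) - g m d * (\<Sum>s\<in>S'. g d s * h s)"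
            unfolding G'_def g_def
            by (simp add: sum_subtractf left_diff_distrib sum_distrib_left mult.assoc)
          also have "(\<Sum>s\<in>S'. g m s * h s) = - (g m d * h d)"
            using row[of m] that by (simp add: eq_neg_iff_add_eq_0 add.commute)
          also have "(\<Sum>s\<in>S'. g d s * h s) = - (g d d * h d)"
            using row[of d] by (simp add: eq_neg_iff_add_eq_0 add.commute)
          finally show ?thesis by simp
        qed
        then have hD: "\<forall>m\<in>D. h m = (\<Sum>s\<in>S' - D. \<gamma> m s * h s)" using \<gamma> by blast
        show ?thesis
        proof (cases "m = d")
          case False
          then show ?thesis using m hD D(2) unfolding \<gamma>'_def by auto
        next
          case True
          have "(\<Sum>s\<in>S'. g d s * h s) = (\<Sum>s\<in>S' - D. g d s * h s) + (\<Sum>m\<in>D. g d m * h m)"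
            using S'(1) D(1) by (metis sum.subset_diff)
          also have "(\<Sum>m\<in>D. g d m * h m) = (\<Sum>m\<in>D. \<Sum>s\<in>S' - D. g d m * \<gamma> m s * h s)"
            using hD by (intro sum.cong refl) (simp add: sum_distrib_left mult.assoc)
          also have "\<dots> = (\<Sum>s\<in>S' - D. (\<Sum>m\<in>D. g d m * \<gamma> m s) * h s)"
            by (subst sum.swap) (simp add: sum_distrib_right)
          finally have "(\<Sum>s\<in>S'. g d s * h s) =
              (\<Sum>s\<in>S' - D. (g d s + (\<Sum>m\<in>D. g d m * \<gamma> m s)) * h s)"
            by (simp add: sum.distrib distrib_right)
          moreover have "h d = - (\<Sum>s\<in>S'. g d s * h s) / g d d"
            using row[of d] g0 by (simp add: field_simps eq_neg_iff_add_eq_0)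
          ultimately have "h d = (\<Sum>s\<in>S' - D. - (g d s + (\<Sum>m\<in>D. g d m * \<gamma> m s)) / g d d * h s)"
            by (simp only: sum_divide_distrib minus_divide_left minus_mult_left times_divide_eq_left
                flip: sum_negf)
          then show ?thesis using True D(2) unfolding \<gamma>'_def by simp
        qed
      qed
      then show ?thesis unfolding g_def by blast
    qed
    then show ?case using fin by blast
  qed
qed

section \<open>Polynomial functions\<close>

definition mon :: "'v set \<Rightarrow> ('v \<Rightarrow> nat) \<Rightarrow> ('v \<Rightarrow> 'a::comm_semiring_1) \<Rightarrow> 'a" where
  "mon J \<alpha> z = (\<Prod>j\<in>J. z j ^ \<alpha> j)"

text \<open>Extensionality on \<open>J\<close> gives each monomial exactly one exponent and makes
  the set finite for finite \<open>J\<close>.\<close>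

definition exponents :: "'v set \<Rightarrow> nat \<Rightarrow> ('v \<Rightarrow> nat) set" where
  "exponents J q = {\<alpha> \<in> J \<rightarrow>\<^sub>E UNIV. sum \<alpha> J \<le> q}"

lemma exponents_le: "finite J \<Longrightarrow> \<alpha> \<in> exponents J q \<Longrightarrow> j \<in> J \<Longrightarrow> \<alpha> j \<le> q"
  unfolding exponents_def by (auto dest: member_le_sum[of j J \<alpha>, rotated 2])

lemma finite_exponents: "finite J \<Longrightarrow> finite (exponents J q)"
  by (rule finite_subset[of _ "J \<rightarrow>\<^sub>E {..q}"])
    (auto simp: exponents_le finite_PiE intro!: PiE_I, auto simp: exponents_def)

text \<open>
  The parameter \<open>\<epsilon>\<close> does not count towards the degree \<open>q\<close>.
\<close>

definition polyfam :: "'v set \<Rightarrow> nat \<Rightarrow> ('a::field \<Rightarrow> ('v \<Rightarrow> 'a) \<Rightarrow> 'a) \<Rightarrow> bool" where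
  "polyfam J q F \<longleftrightarrow>
     (\<exists>c. \<forall>\<epsilon> z. F \<epsilon> z = (\<Sum>\<alpha>\<in>exponents J q. poly (c \<alpha>) \<epsilon> * mon J \<alpha> z))"

abbreviation polyfun :: "'v set \<Rightarrow> nat \<Rightarrow> (('v \<Rightarrow> 'a::field) \<Rightarrow> 'a) \<Rightarrow> bool" where
  "polyfun J q f \<equiv> polyfam J q (\<lambda>_. f)"

lemma polyfam_add:
  "polyfam J q F \<Longrightarrow> polyfam J q G \<Longrightarrow> polyfam J q (\<lambda>\<epsilon> z. F \<epsilon> z + G \<epsilon> z)"
  unfolding polyfam_def
proof (elim exE)
  fix c d
  assume "\<forall>\<epsilon> z. F \<epsilon> z = (\<Sum>\<alpha>\<in>exponents J q. poly (c \<alpha>) \<epsilon> * mon J \<alpha> z)"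
    "\<forall>\<epsilon> z. G \<epsilon> z = (\<Sum>\<alpha>\<in>exponents J q. poly (d \<alpha>) \<epsilon> * mon J \<alpha> z)"
  then show "\<exists>c. \<forall>\<epsilon> z. F \<epsilon> z + G \<epsilon> z = (\<Sum>\<alpha>\<in>exponents J q. poly (c \<alpha>) \<epsilon> * mon J \<alpha> z)"
    by (intro exI[of _ "\<lambda>\<alpha>. c \<alpha> + d \<alpha>"]) (simp add: sum.distrib distrib_right)
qed

lemma polyfam_smult:
  "polyfam J q F \<Longrightarrow> polyfam J q (\<lambda>\<epsilon> z. poly p \<epsilon> * F \<epsilon> z)"
  unfolding polyfam_def
proof (elim exE)
  fix c
  assume "\<forall>\<epsilon> z. F \<epsilon> z = (\<Sum>\<alpha>\<in>exponents J q. poly (c \<alpha>) \<epsilon> * mon J \<alpha> z)"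
  then show "\<exists>c. \<forall>\<epsilon> z. poly p \<epsilon> * F \<epsilon> z = (\<Sum>\<alpha>\<in>exponents J q. poly (c \<alpha>) \<epsilon> * mon J \<alpha> z)"
    by (intro exI[of _ "\<lambda>\<alpha>. p * c \<alpha>"]) (simp add: sum_distrib_left mult.assoc)
qed

lemma polyfam_scale: "polyfam J q F \<Longrightarrow> polyfam J q (\<lambda>\<epsilon> z. k * F \<epsilon> z)"
  using polyfam_smult[of J q F "[:k:]"] by simp

lemma polyfam_mon:
  assumes "finite J" "\<alpha> \<in> exponents J q"
  shows "polyfun J q (mon J \<alpha> :: ('v \<Rightarrow> 'a::field) \<Rightarrow> 'a)"
  unfolding polyfam_def
proof (intro exI allI)
  fix \<epsilon> :: 'a and z :: "'v \<Rightarrow> 'a"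
  have "mon J \<alpha> z = (\<Sum>\<beta>\<in>exponents J q. if \<beta> = \<alpha> then mon J \<beta> z else 0)"
    using assms by (simp add: finite_exponents)
  then show "mon J \<alpha> z = (\<Sum>\<beta>\<in>exponents J q. poly (if \<beta> = \<alpha> then 1 else 0) \<epsilon> * mon J \<beta> z)"
    by (auto simp: if_distrib[of "\<lambda>p. poly p \<epsilon>"] intro!: sum.cong elim!: trans)
qed

lemma polyfam_const:
  assumes "finite J"
  shows "polyfun J q (\<lambda>_. k)"
proof -
  have "restrict (\<lambda>_. 0) J \<in> exponents J q"
    by (auto simp: exponents_def)
  from polyfam_scale[OF polyfam_mon[OF assms this], of k] show ?thesis
    by (simp add: mon_def)
qed

lemma polyfam_sum:
  assumes "finite J" "\<And>x. x \<in> X \<Longrightarrow> polyfam J q (F x)"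
  shows "polyfam J q (\<lambda>\<epsilon> z. \<Sum>x\<in>X. F x \<epsilon> z)"
  using assms(2)
  by (induction X rule: infinite_finite_induct)
    (auto simp: polyfam_const[OF assms(1)] intro: polyfam_add)

lemma polyfam_var:
  assumes "finite J" "v \<in> J"
  shows "polyfun J (Suc q) (\<lambda>z :: 'v \<Rightarrow> 'a::field. z v)"
proof -
  define \<alpha> where "\<alpha> = (\<lambda>j\<in>J. if j = v then Suc 0 else 0)"
  have "\<alpha> \<in> exponents J (Suc q)"
    using assms by (auto simp: exponents_def \<alpha>_def)
  moreover have "mon J \<alpha> = (\<lambda>z :: 'v \<Rightarrow> 'a. z v)"
  proof
    fix z :: "'v \<Rightarrow> 'a"
    have "mon J \<alpha> z = (\<Prod>j\<in>J. if j = v then z j else 1)"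
      unfolding mon_def by (rule prod.cong) (auto simp: \<alpha>_def)
    then show "mon J \<alpha> z = z v" using assms by simp
  qed
  ultimately show ?thesis using polyfam_mon[OF assms(1), of \<alpha> "Suc q"] by metis
qed

lemma polyfun_mon_mult:
  assumes "finite J" "\<alpha> \<in> exponents J p" "\<beta> \<in> exponents J q"
  shows "polyfun J (p + q) (\<lambda>z :: 'v \<Rightarrow> 'a::field. mon J \<alpha> z * mon J \<beta> z)"
proof -
  define \<gamma> where "\<gamma> = (\<lambda>j\<in>J. \<alpha> j + \<beta> j)"
  have "\<gamma> \<in> exponents J (p + q)"
    using assms by (auto simp: exponents_def sum.distrib \<gamma>_def)
  moreover have "mon J \<gamma> = (\<lambda>z :: 'v \<Rightarrow> 'a. mon J \<alpha> z * mon J \<beta> z)"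
    by (rule ext) (simp add: mon_def \<gamma>_def power_add prod.distrib)
  ultimately show ?thesis using polyfam_mon[OF assms(1), of \<gamma> "p + q"] by metis
qed

lemma polyfam_mult:
  assumes "finite J" "polyfam J p F" "polyfam J q G"
  shows "polyfam J (p + q) (\<lambda>\<epsilon> z. F \<epsilon> z * G \<epsilon> z)"
proof -
  obtain c where c: "\<And>\<epsilon> z. F \<epsilon> z = (\<Sum>\<alpha>\<in>exponents J p. poly (c \<alpha>) \<epsilon> * mon J \<alpha> z)"
    using assms(2) unfolding polyfam_def by blast
  obtain d where d: "\<And>\<epsilon> z. G \<epsilon> z = (\<Sum>\<beta>\<in>exponents J q. poly (d \<beta>) \<epsilon> * mon J \<beta> z)"
    using assms(3) unfolding polyfam_def by blast
  have "F \<epsilon> z * G \<epsilon> z = (\<Sum>\<alpha>\<in>exponents J p. \<Sum>\<beta>\<in>exponents J q.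
      poly (c \<alpha> * d \<beta>) \<epsilon> * (mon J \<alpha> z * mon J \<beta> z))" for \<epsilon> z
    unfolding c d by (simp add: sum_product mult_ac)
  moreover have "polyfam J (p + q) (\<lambda>\<epsilon> z. \<Sum>\<alpha>\<in>exponents J p. \<Sum>\<beta>\<in>exponents J q.
      poly (c \<alpha> * d \<beta>) \<epsilon> * (mon J \<alpha> z * mon J \<beta> z))"
    using assms(1) by (intro polyfam_sum polyfam_smult polyfun_mon_mult)
  ultimately show ?thesis by simp
qed

lemma polyfam_mono:
  assumes "finite J" "polyfam J p F" "p \<le> q"
  shows "polyfam J q F"
  using polyfam_mult[OF assms(1,2) polyfam_const[OF assms(1), of "q - p" 1]] assms(3) by simp

lemma polyfam_power:
  assumes "finite J" "polyfam J p F"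
  shows "polyfam J (n * p) (\<lambda>\<epsilon> z. F \<epsilon> z ^ n)"
  by (induction n) (auto intro: polyfam_const polyfam_mult assms)

lemma polyfam_prod:
  assumes "finite J" "\<And>x. x \<in> X \<Longrightarrow> polyfam J (p x) (F x)"
  shows "polyfam J (sum p X) (\<lambda>\<epsilon> z. \<Prod>x\<in>X. F x \<epsilon> z)"
  using assms(2)
  by (induction X rule: infinite_finite_induct)
    (auto intro: polyfam_const polyfam_mult assms)

lemma polyfam_at: "polyfam J q F \<Longrightarrow> polyfun J q (F \<epsilon>)"
  unfolding polyfam_def
proof (elim exE)
  fix c
  assume "\<forall>\<epsilon> z. F \<epsilon> z = (\<Sum>\<alpha>\<in>exponents J q. poly (c \<alpha>) \<epsilon> * mon J \<alpha> z)"
  then show "\<exists>c. \<forall>x z. F \<epsilon> z = (\<Sum>\<alpha>\<in>exponents J q. poly (c \<alpha>) x * mon J \<alpha> z)"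
    by (intro exI[of _ "\<lambda>\<alpha>. [:poly (c \<alpha>) \<epsilon>:]"]) simp
qed

lemma polyfun_expand:
  "polyfun J q f \<Longrightarrow> \<exists>\<beta>. \<forall>z. f z = (\<Sum>\<alpha>\<in>exponents J q. \<beta> \<alpha> * mon J \<alpha> z)"
proof -
  assume "polyfun J q f"
  then obtain c where "\<forall>\<epsilon> z. f z = (\<Sum>\<alpha>\<in>exponents J q. poly (c \<alpha>) \<epsilon> * mon J \<alpha> z)"
    unfolding polyfam_def by blast
  then show ?thesis by (intro exI[of _ "\<lambda>\<alpha>. poly (c \<alpha>) 0"]) blast
qed

lemma polyfun_compose:
  assumes "finite I" "finite J" "polyfun I q f" "\<And>v. v \<in> I \<Longrightarrow> polyfun J p (\<lambda>z. L z v)"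
  shows "polyfun J (q * p) (\<lambda>z. f (L z))"
proof -
  obtain \<beta> where \<beta>: "\<And>z. f z = (\<Sum>\<alpha>\<in>exponents I q. \<beta> \<alpha> * mon I \<alpha> z)"
    using polyfun_expand[OF assms(3)] by blast
  have "polyfun J (q * p) (\<lambda>z. mon I \<alpha> (L z))" if "\<alpha> \<in> exponents I q" for \<alpha>
  proof (rule polyfam_mono[OF assms(2)])
    show "polyfun J (\<Sum>v\<in>I. \<alpha> v * p) (\<lambda>z. mon I \<alpha> (L z))"
      unfolding mon_def using assms by (intro polyfam_prod polyfam_power)
    show "(\<Sum>v\<in>I. \<alpha> v * p) \<le> q * p"
      using that by (auto simp: exponents_def simp flip: sum_distrib_right)
  qed
  then show ?thesis unfolding \<beta> using assms(2) by (intro polyfam_sum polyfam_scale)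
qed

text \<open>Reduces vanishing in many variables to the finiteness of roots in one.\<close>

lemma polyfun_line:
  assumes "polyfun J q f"
  shows "\<exists>P. \<forall>s. f (\<lambda>v. a v + s * b v) = poly P s"
proof -
  obtain \<beta> where \<beta>: "\<And>z. f z = (\<Sum>\<alpha>\<in>exponents J q. \<beta> \<alpha> * mon J \<alpha> z)"
    using polyfun_expand[OF assms] by blast
  show ?thesis
    by (rule exI[of _ "\<Sum>\<alpha>\<in>exponents J q. [:\<beta> \<alpha>:] * (\<Prod>j\<in>J. [:a j, b j:] ^ \<alpha> j)"])
      (simp add: \<beta> mon_def poly_sum poly_prod)
qed

lemma poly_eq_0_if_vanishing:
  fixes P :: "'a::field poly"
  assumes "infinite (UNIV :: 'a set)" "\<And>s. poly P s = 0"
  shows "P = 0"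
  using poly_roots_finite[of P] assms by auto

subsection \<open>Zariski closed sets\<close>

lemma eval_poly_superset:
  assumes "finite S" "Poly_Mapping.keys p \<subseteq> S"
  shows "eval_poly p x = (\<Sum>m\<in>S. Poly_Mapping.lookup p m *
           (\<Prod>v\<in>Poly_Mapping.keys m. x v ^ Poly_Mapping.lookup m v))"
  unfolding eval_poly_def
  by (rule sum.mono_neutral_left) (use assms in \<open>auto simp: in_keys_iff\<close>)

lemma eval_poly_0 [simp]: "eval_poly 0 x = 0"
  by (simp add: eval_poly_def)

lemma eval_poly_add: "eval_poly (p + q) x = eval_poly p x + eval_poly q x"
  using Poly_Mapping.keys_add[of p q]
  by (simp add: eval_poly_superset[of "Poly_Mapping.keys p \<union> Poly_Mapping.keys q"]
      lookup_add distrib_right sum.distrib)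

text \<open>Together with its converse \<open>eval_poly_polyfun\<close> this lets all arguments run
  on functions with a degree bound, although \<open>zariski_closed\<close> speaks of formal
  polynomials.\<close>

lemma polyfun_eval_poly:
  fixes f :: "('v \<Rightarrow> 'a::field) \<Rightarrow> 'a"
  assumes "finite I" "polyfun I q f"
  shows "\<exists>p\<in>poly_ring I. \<forall>x. eval_poly p x = f x"
proof -
  obtain \<beta> where \<beta>: "\<And>z. f z = (\<Sum>\<alpha>\<in>exponents I q. \<beta> \<alpha> * mon I \<alpha> z)"
    using polyfun_expand[OF assms(2)] by blast
  have "\<exists>p\<in>poly_ring I. \<forall>x. eval_poly p x = (\<Sum>\<alpha>\<in>A. \<beta> \<alpha> * mon I \<alpha> x)" if "finite A" for A
    using that
  proof (induction A rule: finite_induct)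
    case empty
    show ?case by (rule bexI[of _ 0]) (auto simp: poly_ring_def)
  next
    case (insert \<alpha> A)
    then obtain p where p: "p \<in> poly_ring I" "\<And>x. eval_poly p x = (\<Sum>\<alpha>\<in>A. \<beta> \<alpha> * mon I \<alpha> x)"
      by blast
    \<comment> \<open>Exponents are \<open>undefined\<close> outside \<open>I\<close>, whereas a
      formal monomial needs 0 there.\<close>
    define m where "m = Poly_Mapping.Abs_poly_mapping (\<lambda>v. if v \<in> I then \<alpha> v else 0)"
    have "finite {v. (if v \<in> I then \<alpha> v else 0) \<noteq> 0}"
      by (rule finite_subset[OF _ assms(1)]) auto
    then have m: "Poly_Mapping.lookup m v = (if v \<in> I then \<alpha> v else 0)" for v
      unfolding m_def by (subst lookup_Abs_poly_mapping) auto
    have keys: "Poly_Mapping.keys m \<subseteq> I"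
      by (auto simp: in_keys_iff m split: if_splits)
    have "(\<Prod>v\<in>Poly_Mapping.keys m. x v ^ Poly_Mapping.lookup m v) = mon I \<alpha> x" for x :: "'v \<Rightarrow> 'a"
    proof -
      have "(\<Prod>v\<in>Poly_Mapping.keys m. x v ^ Poly_Mapping.lookup m v) =
          (\<Prod>v\<in>I. x v ^ Poly_Mapping.lookup m v)"
        by (rule prod.mono_neutral_left[OF assms(1) keys]) (simp add: in_keys_iff)
      then show ?thesis unfolding mon_def by (simp add: m)
    qed
    then have "eval_poly (Poly_Mapping.single m (\<beta> \<alpha>)) x = \<beta> \<alpha> * mon I \<alpha> x" for x
      by (subst eval_poly_superset[of "{m}"]) auto
    then have "eval_poly (Poly_Mapping.single m (\<beta> \<alpha>) + p) x = (\<Sum>\<alpha>\<in>insert \<alpha> A. \<beta> \<alpha> * mon I \<alpha> x)" for x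
      using insert by (simp add: eval_poly_add p(2))
    moreover have "Poly_Mapping.single m (\<beta> \<alpha>) + p \<in> poly_ring I"
      using p(1) keys Poly_Mapping.keys_add[of "Poly_Mapping.single m (\<beta> \<alpha>)" p]
      unfolding poly_ring_def by (auto split: if_splits)
    ultimately show ?case by blast
  qed
  from this[OF finite_exponents[OF assms(1)]] show ?thesis unfolding \<beta> .
qed

lemma eval_poly_polyfun:
  assumes "finite I" "p \<in> poly_ring I"
  shows "\<exists>q. polyfun I q (eval_poly p)"
proof -
  define deg where "deg m = (\<Sum>v\<in>Poly_Mapping.keys m. Poly_Mapping.lookup m v * 1)" for m :: "'a \<Rightarrow>\<^sub>0 nat"
  have "polyfun I (\<Sum>m\<in>Poly_Mapping.keys p. deg m)
      (\<lambda>z. \<Prod>v\<in>Poly_Mapping.keys m. z v ^ Poly_Mapping.lookup m v)"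
    if m: "m \<in> Poly_Mapping.keys p" for m
  proof (rule polyfam_mono[OF assms(1)])
    have "Poly_Mapping.keys m \<subseteq> I" using assms m by (auto simp: poly_ring_def)
    then show "polyfun I (deg m) (\<lambda>z. \<Prod>v\<in>Poly_Mapping.keys m. z v ^ Poly_Mapping.lookup m v)"
      unfolding deg_def using assms(1) polyfam_var[OF assms(1), of _ 0]
      by (intro polyfam_prod polyfam_power) auto
    show "deg m \<le> (\<Sum>m\<in>Poly_Mapping.keys p. deg m)"
      using m by (intro member_le_sum) auto
  qed
  then have "polyfun I (\<Sum>m\<in>Poly_Mapping.keys p. deg m) (eval_poly p)"
    unfolding eval_poly_def by (intro polyfam_sum[OF assms(1)] polyfam_scale)
  then show ?thesis by blast
qed

lemma zariski_closed_Int_zeros: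
  assumes "finite I" "zariski_closed I V" "polyfun I q f"
  shows "zariski_closed I (V \<inter> {x. f x = 0})"
proof -
  obtain P where P: "P \<subseteq> poly_ring I" "V = {x \<in> affine_space I. \<forall>p\<in>P. eval_poly p x = 0}"
    using assms(2) unfolding zariski_closed_def by blast
  obtain p where "p \<in> poly_ring I" "\<forall>x. eval_poly p x = f x"
    using polyfun_eval_poly[OF assms(1,3)] by blast
  then show ?thesis unfolding zariski_closed_def
    by (intro exI[of _ "insert p P"]) (use P in auto)
qed

text \<open>The zero loci of \<open>f\<close> and \<open>g\<close> cut \<open>V\<close> into two
  closed pieces, so functions on an irreducible set have no zero divisors.\<close>

lemma irreducible_closed_mult_zero:
  assumes "finite I" "irreducible_closed I V" "polyfun I p f" "polyfun I q g"
    and "\<And>x. x \<in> V \<Longrightarrow> f x * g x = 0"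
  shows "(\<forall>x\<in>V. f x = 0) \<or> (\<forall>x\<in>V. g x = 0)"
proof -
  have "V = (V \<inter> {x. f x = 0}) \<union> (V \<inter> {x. g x = 0})" using assms(5) by auto
  moreover have "zariski_closed I V" using assms(2) unfolding irreducible_closed_def by blast
  then have "zariski_closed I (V \<inter> {x. f x = 0})" "zariski_closed I (V \<inter> {x. g x = 0})"
    using zariski_closed_Int_zeros assms by blast+
  ultimately have "V = V \<inter> {x. f x = 0} \<or> V = V \<inter> {x. g x = 0}"
    using assms(2) unfolding irreducible_closed_def by blast
  then show ?thesis by auto
qed

lemma zariski_closed_separate:
  assumes "finite I" "zariski_closed I V" "x \<in> affine_space I" "x \<notin> V"
  shows "\<exists>q f. polyfun I q f \<and> (\<forall>y\<in>V. f y = 0) \<and> f x \<noteq> 0"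
proof -
  obtain P where P: "P \<subseteq> poly_ring I" "V = {x \<in> affine_space I. \<forall>p\<in>P. eval_poly p x = 0}"
    using assms(2) unfolding zariski_closed_def by blast
  then obtain p where p: "p \<in> P" "eval_poly p x \<noteq> 0" using assms by auto
  then obtain q where "polyfun I q (eval_poly p)" using eval_poly_polyfun assms(1) P by blast
  then show ?thesis using p P(2) by blast
qed

section \<open>Algebraic independence on a set\<close>

text \<open>
  A polynomial relation is a family \<open>c\<close> of coefficients over the exponents bounded by some \<open>b\<close>.
\<close>

definition alg_indep :: "('k \<Rightarrow> 'x \<Rightarrow> 'a::field) \<Rightarrow> 'k set \<Rightarrow> 'x set \<Rightarrow> bool" where
  "alg_indep f D S \<longleftrightarrow>
     (\<forall>b c. (\<forall>x\<in>S. (\<Sum>\<alpha>\<in>D \<rightarrow>\<^sub>E {..b}. c \<alpha> * mon D \<alpha> (\<lambda>k. f k x)) = 0) \<longrightarrow>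
       (\<forall>\<alpha>\<in>D \<rightarrow>\<^sub>E {..b::nat}. c \<alpha> = 0))"

lemma alg_indepD:
  assumes "alg_indep f D S" "\<And>x. x \<in> S \<Longrightarrow> (\<Sum>\<alpha>\<in>D \<rightarrow>\<^sub>E {..b}. c \<alpha> * mon D \<alpha> (\<lambda>k. f k x)) = 0"
    and "\<alpha> \<in> D \<rightarrow>\<^sub>E {..b}"
  shows "c \<alpha> = 0"
  using assms unfolding alg_indep_def by blast

lemma alg_indep_empty: "S \<noteq> {} \<Longrightarrow> alg_indep f {} S"
  unfolding alg_indep_def by (auto simp: mon_def)

text \<open>A relation in \<open>f'\<close> takes at the matching point \<open>y\<close> the value
  of the same relation in \<open>f\<close> at \<open>x\<close>. This carries independence back along
  a substitution that reaches every point of \<open>S\<close>.\<close>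

lemma alg_indep_transport:
  assumes "alg_indep f D S" "\<And>x. x \<in> S \<Longrightarrow> \<exists>y\<in>S'. \<forall>k\<in>D. f' k y = f k x"
  shows "alg_indep f' D S'"
  unfolding alg_indep_def
proof (intro allI impI ballI)
  fix b c \<alpha>
  assume c: "\<forall>x\<in>S'. (\<Sum>\<alpha>\<in>D \<rightarrow>\<^sub>E {..b}. c \<alpha> * mon D \<alpha> (\<lambda>k. f' k x)) = 0"
    and \<alpha>: "\<alpha> \<in> D \<rightarrow>\<^sub>E {..b}"
  show "c \<alpha> = 0"
  proof (rule alg_indepD[OF assms(1) _ \<alpha>])
    fix x assume "x \<in> S"
    then obtain y where y: "y \<in> S'" "\<forall>k\<in>D. f' k y = f k x" using assms(2) by blast
    then have "mon D \<alpha> (\<lambda>k. f' k y) = mon D \<alpha> (\<lambda>k. f k x)" for \<alpha>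
      unfolding mon_def by simp
    then show "(\<Sum>\<alpha>\<in>D \<rightarrow>\<^sub>E {..b}. c \<alpha> * mon D \<alpha> (\<lambda>k. f k x)) = 0" using bspec[OF c y(1)] by simp
  qed
qed

lemma Inl_in_Plus_iff [simp]: "Inl a \<in> A <+> B \<longleftrightarrow> a \<in> A"
  and Inr_in_Plus_iff [simp]: "Inr b \<in> A <+> B \<longleftrightarrow> b \<in> B"
  by auto

lemma sum_PiE_insert:
  assumes "k \<notin> D"
  shows "(\<Sum>\<alpha>\<in>insert k D \<rightarrow>\<^sub>E B. F \<alpha>) = (\<Sum>j\<in>B. \<Sum>\<alpha>\<in>D \<rightarrow>\<^sub>E B. F (\<alpha>(k := j)))"
proof -
  have "(\<Sum>\<alpha>\<in>insert k D \<rightarrow>\<^sub>E B. F \<alpha>) = (\<Sum>(j, \<alpha>)\<in>B \<times> (D \<rightarrow>\<^sub>E B). F (\<alpha>(k := j)))"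
    unfolding PiE_insert_eq
    by (subst sum.reindex[OF inj_combinator[OF assms]]) (simp add: case_prod_beta)
  then show ?thesis by (simp add: sum.cartesian_product)
qed

text \<open>A relation is read as a polynomial in \<open>f k\<close> whose coefficients are
  relations among \<open>D\<close>, and these are eliminated by induction on the power of
  \<open>f k\<close>. The last assumption isolates what differs between the two applications, a
  function vanishing on a smaller irreducible set and a free variable. In the former the
  coefficients are controlled only on that smaller set, hence two sets \<open>S\<close> and
  \<open>S'\<close>.\<close>

lemma alg_indep_insert:
  assumes "finite D" "k \<notin> D" "alg_indep f D S'"
    and "\<And>b (c :: nat \<Rightarrow> ('k \<Rightarrow> nat) \<Rightarrow> 'a::field) j x.
      \<lbrakk>\<And>x. x \<in> S \<Longrightarrow> (\<Sum>j\<le>b. (\<Sum>\<alpha>\<in>D \<rightarrow>\<^sub>E {..b}. c j \<alpha> * mon D \<alpha> (\<lambda>k. f k x)) * f k x ^ j) = 0;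
       \<And>i \<alpha>. i < j \<Longrightarrow> \<alpha> \<in> D \<rightarrow>\<^sub>E {..b} \<Longrightarrow> c i \<alpha> = 0; j \<le> b; x \<in> S'\<rbrakk>
      \<Longrightarrow> (\<Sum>\<alpha>\<in>D \<rightarrow>\<^sub>E {..b}. c j \<alpha> * mon D \<alpha> (\<lambda>k. f k x)) = 0"
  shows "alg_indep f (insert k D) S"
  unfolding alg_indep_def
proof (intro allI impI ballI)
  fix b c \<alpha>
  assume *: "\<forall>x\<in>S. (\<Sum>\<alpha>\<in>insert k D \<rightarrow>\<^sub>E {..b}. c \<alpha> * mon (insert k D) \<alpha> (\<lambda>k. f k x)) = 0"
    and \<alpha>: "\<alpha> \<in> insert k D \<rightarrow>\<^sub>E {..b}"
  define c' where "c' j \<alpha> = c (\<alpha>(k := j))" for j \<alpha>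
  have mon_upd: "mon (insert k D) (\<alpha>(k := j)) y = mon D \<alpha> y * y k ^ j" for \<alpha> j and y :: "'k \<Rightarrow> 'a"
  proof -
    have "(\<Prod>i\<in>D. y i ^ (\<alpha>(k := j)) i) = (\<Prod>i\<in>D. y i ^ \<alpha> i)"
      using assms(2) by (intro prod.cong) auto
    then show ?thesis using assms(1,2) by (simp add: mon_def mult.commute)
  qed
  have rel: "(\<Sum>j\<le>b. (\<Sum>\<alpha>\<in>D \<rightarrow>\<^sub>E {..b}. c' j \<alpha> * mon D \<alpha> (\<lambda>k. f k x)) * f k x ^ j) = 0"
    if "x \<in> S" for x
    using bspec[OF * that]
    by (simp add: sum_PiE_insert[OF assms(2)] mon_upd c'_def sum_distrib_right mult.assoc)
  have c': "c' j \<alpha> = 0" if "j \<le> b" "\<alpha> \<in> D \<rightarrow>\<^sub>E {..b}" for j \<alpha>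
    using that
  proof (induction j arbitrary: \<alpha> rule: less_induct)
    case (less j)
    then have lower: "c' i \<beta> = 0" if "i < j" "\<beta> \<in> D \<rightarrow>\<^sub>E {..b}" for i \<beta> using that by auto
    show ?case
      by (rule alg_indepD[OF assms(3) _ less.prems(2)], rule assms(4)[OF rel lower less.prems(1)])
  qed
  have \<alpha>k: "\<alpha> k \<le> b" using \<alpha> by auto
  have "\<alpha>(k := undefined) \<in> D \<rightarrow>\<^sub>E {..b}" using \<alpha> assms(2) by (auto simp: PiE_def extensional_def)
  from c'[OF \<alpha>k this] show "c \<alpha> = 0" by (simp add: c'_def)
qed

lemma polyfun_power_product:
  fixes f :: "'k \<Rightarrow> ('v \<Rightarrow> 'a::field) \<Rightarrow> 'a"
  assumes "finite J" "finite D" "\<And>k. k \<in> D \<Longrightarrow> polyfun J q (f k)" "\<alpha> \<in> D \<rightarrow>\<^sub>E {..b}"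
  shows "polyfun J (card D * b * q) (\<lambda>z. mon D \<alpha> (\<lambda>k. f k z))"
proof (rule polyfam_mono[OF assms(1)])
  show "polyfun J (\<Sum>k\<in>D. \<alpha> k * q) (\<lambda>z. mon D \<alpha> (\<lambda>k. f k z))"
    unfolding mon_def using assms by (intro polyfam_prod polyfam_power) auto
  have "(\<Sum>k\<in>D. \<alpha> k * q) \<le> (\<Sum>k\<in>D. b * q)"
    using assms(4) by (intro sum_mono mult_right_mono) auto
  then show "(\<Sum>k\<in>D. \<alpha> k * q) \<le> card D * b * q" by simp
qed

text \<open>
  A function vanishing on \<open>Z\<close> but not on the larger irreducible set \<open>Z'\<close> is transcendental over
  the functions that are independent on \<open>Z\<close>: cancel its lowest power from a relation, then
  restrict the relation to \<open>Z\<close>.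
\<close>

lemma alg_indep_insert_irreducible:
  assumes "finite I" "finite D" "k \<notin> D" "alg_indep f D Z" "irreducible_closed I Z'" "Z \<subseteq> Z'"
    and "\<And>i. i \<in> insert k D \<Longrightarrow> polyfun I q (f i)"
    and "\<And>x. x \<in> Z \<Longrightarrow> f k x = 0" "\<exists>x\<in>Z'. f k x \<noteq> 0"
  shows "alg_indep f (insert k D) Z'"
proof (rule alg_indep_insert[OF assms(2-4)])
  fix b c j x
  assume rel: "\<And>x. x \<in> Z' \<Longrightarrow>
      (\<Sum>j\<le>b. (\<Sum>\<alpha>\<in>D \<rightarrow>\<^sub>E {..b}. c j \<alpha> * mon D \<alpha> (\<lambda>k. f k x)) * f k x ^ j) = 0"
    and lower: "\<And>i \<alpha>. i < j \<Longrightarrow> \<alpha> \<in> D \<rightarrow>\<^sub>E {..b} \<Longrightarrow> c i \<alpha> = 0" and j: "j \<le> b" and x: "x \<in> Z"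
  define h where "h i x = (\<Sum>\<alpha>\<in>D \<rightarrow>\<^sub>E {..b}. c i \<alpha> * mon D \<alpha> (\<lambda>k. f k x))" for i x
  define r where "r x = (\<Sum>i\<in>{j..b}. h i x * f k x ^ (i - j))" for x
  have h: "polyfun I (card D * b * q) (h i)" for i
    unfolding h_def using assms(1,2,7)
    by (intro polyfam_sum polyfam_scale polyfun_power_product) auto
  have fk: "polyfun I (m * q) (\<lambda>x. f k x ^ m)" for m
    using assms(1,7) by (intro polyfam_power) auto
  have "polyfun I (card D * b * q + b * q) r"
    unfolding r_def
  proof (rule polyfam_sum[OF assms(1)], rule polyfam_mult[OF assms(1) h], rule polyfam_mono[OF assms(1) fk])
    fix i assume "i \<in> {j..b}"
    then show "(i - j) * q \<le> b * q" by (intro mult_right_mono) auto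
  qed
  moreover have "f k x ^ j * r x = 0" if "x \<in> Z'" for x
  proof -
    have "(\<Sum>i\<le>b. h i x * f k x ^ i) = (\<Sum>i\<in>{j..b}. h i x * f k x ^ i)"
      by (rule sum.mono_neutral_right) (auto simp: h_def lower not_le)
    also have "\<dots> = f k x ^ j * r x"
      unfolding r_def sum_distrib_left
      by (rule sum.cong) (auto simp: mult_ac simp flip: power_add)
    finally show ?thesis using rel[OF that] by (simp add: h_def)
  qed
  ultimately have "(\<forall>x\<in>Z'. f k x ^ j = 0) \<or> (\<forall>x\<in>Z'. r x = 0)"
    using irreducible_closed_mult_zero[OF assms(1,5) fk] by blast
  then have "r x = 0" using assms(6,9) x by auto
  \<comment> \<open>On \<open>Z\<close> every term with \<open>i > j\<close> contains a positive
    power of \<open>f k x = 0\<close>; the term \<open>i = j\<close> stays because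
    \<open>0 ^ 0 = 1\<close>.\<close>
  moreover have "r x = (\<Sum>i\<in>{j}. h i x * f k x ^ (i - j))"
    unfolding r_def by (rule sum.mono_neutral_right) (use j x assms(8) in \<open>auto simp: zero_power\<close>)
  ultimately have "h j x = 0" by simp
  then show "(\<Sum>\<alpha>\<in>D \<rightarrow>\<^sub>E {..b}. c j \<alpha> * mon D \<alpha> (\<lambda>k. f k x)) = 0" by (simp add: h_def)
qed

text \<open>Each strict inclusion supplies a polynomial vanishing on \<open>Z i\<close> but not on
  \<open>Z (Suc i)\<close>, and it is adjoined to those found below. This is the part of the
  comparison between Krull dimension and transcendence degree that the bound requires.\<close>

lemma chain_alg_indep:
  fixes Z :: "nat \<Rightarrow> ('v \<Rightarrow> 'a::field) set"
  assumes "finite I" "\<And>i. i \<le> d \<Longrightarrow> irreducible_closed I (Z i)" "\<And>i. i < d \<Longrightarrow> Z i \<subset> Z (Suc i)"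
  shows "\<exists>q f. (\<forall>i<d. polyfun I q (f i)) \<and> alg_indep f {..<d} (Z d)"
proof -
  have closed: "zariski_closed I (Z i)" "Z i \<noteq> {}" if "i \<le> d" for i
    using assms(2)[OF that] unfolding irreducible_closed_def by auto
  have "\<exists>q f. polyfun I q f \<and> (\<forall>x\<in>Z i. f x = 0) \<and> (\<exists>x\<in>Z (Suc i). f x \<noteq> 0)" if i: "i < d" for i
  proof -
    obtain x where x: "x \<in> Z (Suc i)" "x \<notin> Z i" using assms(3)[OF i] by blast
    have "x \<in> affine_space I" using closed(1)[of "Suc i"] i x unfolding zariski_closed_def by auto
    then show ?thesis
      using zariski_closed_separate[OF assms(1) closed(1)[of i]] i x by fastforce
  qed
  then obtain q f where f: "\<And>i. i < d \<Longrightarrow> polyfun I (q i) (f i)" "\<And>i x. i < d \<Longrightarrow> x \<in> Z i \<Longrightarrow> f i x = 0"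
    "\<And>i. i < d \<Longrightarrow> \<exists>x\<in>Z (Suc i). f i x \<noteq> 0"
    by metis
  \<comment> \<open>A degree bound common to all \<open>f i\<close>.\<close>
  define Q where "Q = (\<Sum>i<d. q i)"
  have Q: "polyfun I Q (f i)" if "i < d" for i
    using that by (intro polyfam_mono[OF assms(1) f(1)[OF that]]) (auto simp: Q_def intro: member_le_sum)
  have "alg_indep f {..<i} (Z i)" if "i \<le> d" for i
    using that
  proof (induction i)
    case 0
    then show ?case using alg_indep_empty[OF closed(2)[of 0]] by simp
  next
    case (Suc i)
    show ?case unfolding lessThan_Suc
    proof (rule alg_indep_insert_irreducible[where I = I and Z = "Z i" and q = Q])
      show "alg_indep f {..<i} (Z i)" "irreducible_closed I (Z (Suc i))" "Z i \<subseteq> Z (Suc i)"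
        using Suc assms(2)[of "Suc i"] assms(3)[of i] by auto
      show "polyfun I Q (f j)" if "j \<in> insert i {..<i}" for j
        using that Suc.prems by (intro Q) auto
      show "f i x = 0" if "x \<in> Z i" for x using f(2)[of i] Suc.prems that by auto
      show "\<exists>x\<in>Z (Suc i). f i x \<noteq> 0" using f(3)[of i] Suc.prems by auto
    qed (use assms(1) in auto)
  qed
  then show ?thesis using Q by blast
qed

text \<open>With \<open>x\<close> and the other entries of \<open>t\<close> fixed, a relation is a
  polynomial in \<open>t l\<close> with infinitely many zeros. Its coefficients, which are relations
  among the remaining functions, therefore vanish.\<close>

lemma alg_indep_free_variables:
  fixes f :: "'k \<Rightarrow> 'x \<Rightarrow> 'a::field" and D' :: "'l set"
  assumes inf: "infinite (UNIV :: 'a set)" and "finite D" "finite D'" "alg_indep f D S"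
  shows "alg_indep (\<lambda>k (x, t). case k of Inl k \<Rightarrow> f k x | Inr l \<Rightarrow> t l) (D <+> D') (S \<times> UNIV)"
    (is "alg_indep ?F _ _")
  using assms(3)
proof (induction D' rule: finite_induct)
  case empty
  show ?case
    unfolding alg_indep_def
  proof (intro allI impI ballI)
    fix b c \<alpha>
    assume *: "\<forall>y\<in>S \<times> UNIV. (\<Sum>\<alpha>\<in>(D <+> {}) \<rightarrow>\<^sub>E {..b}. c \<alpha> * mon (D <+> {}) \<alpha> (\<lambda>k. ?F k y)) = 0"
      and \<alpha>: "\<alpha> \<in> (D <+> ({} :: 'l set)) \<rightarrow>\<^sub>E {..b}"
    \<comment> \<open>The base case is mere reindexing: \<open>D <+> {}\<close> is a tagged copy of
      \<open>D\<close>.\<close>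
    define L :: "('k \<Rightarrow> nat) \<Rightarrow> 'k + 'l \<Rightarrow> nat" where "L \<alpha> = case_sum \<alpha> (\<lambda>_. undefined)" for \<alpha>
    have bij: "bij_betw L (D \<rightarrow>\<^sub>E {..b}) ((D <+> {}) \<rightarrow>\<^sub>E {..b})"
    proof (rule bij_betwI[where g = "\<lambda>\<alpha>. \<alpha> \<circ> Inl"])
      show "L \<in> (D \<rightarrow>\<^sub>E {..b}) \<rightarrow> ((D <+> {}) \<rightarrow>\<^sub>E {..b})"
      proof (intro Pi_I PiE_I)
        fix \<alpha> k assume \<alpha>: "\<alpha> \<in> D \<rightarrow>\<^sub>E {..b}"
        show "L \<alpha> k \<in> {..b}" if "k \<in> D <+> {}" using \<alpha> that by (auto simp: L_def)
        show "L \<alpha> k = undefined" if "k \<notin> D <+> {}"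
          using PiE_arb[OF \<alpha>] that by (cases k) (auto simp: L_def)
      qed
      show "(\<lambda>\<alpha>. \<alpha> \<circ> Inl) \<in> ((D <+> ({} :: 'l set)) \<rightarrow>\<^sub>E {..b}) \<rightarrow> (D \<rightarrow>\<^sub>E {..b})"
        by (auto simp: PiE_def extensional_def)
      show "L (\<alpha> \<circ> Inl) = \<alpha>" if "\<alpha> \<in> (D <+> {}) \<rightarrow>\<^sub>E {..b}" for \<alpha>
      proof
        fix k show "L (\<alpha> \<circ> Inl) k = \<alpha> k"
          using PiE_arb[OF that, of k] by (cases k) (auto simp: L_def Plus_def image_iff)
      qed
      show "(\<lambda>\<alpha>. \<alpha> \<circ> Inl) (L \<alpha>) = \<alpha>" for \<alpha> by (simp add: L_def comp_def)
    qed
    have mon: "mon (D <+> {}) (L \<alpha>) (\<lambda>k. ?F k (x, t)) = mon D \<alpha> (\<lambda>k. f k x)" for \<alpha> x t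
      by (simp add: mon_def Plus_def prod.reindex L_def)
    obtain \<alpha>' where \<alpha>': "\<alpha>' \<in> D \<rightarrow>\<^sub>E {..b}" "\<alpha> = L \<alpha>'" using bij \<alpha> unfolding bij_betw_def by blast
    have "c (L \<alpha>') = 0"
    proof (rule alg_indepD[OF assms(4) _ \<alpha>'(1)])
      fix x assume "x \<in> S"
      then have "(\<Sum>\<alpha>\<in>(D <+> {}) \<rightarrow>\<^sub>E {..b}. c \<alpha> * mon (D <+> {}) \<alpha> (\<lambda>k. ?F k (x, undefined))) = 0"
        using * by auto
      then show "(\<Sum>\<alpha>\<in>D \<rightarrow>\<^sub>E {..b}. c (L \<alpha>) * mon D \<alpha> (\<lambda>k. f k x)) = 0"
        by (simp add: sum.reindex_bij_betw[OF bij, symmetric] mon[simplified])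
    qed
    then show "c \<alpha> = 0" using \<alpha>' by simp
  qed
next
  case (insert l D')
  have "alg_indep ?F (insert (Inr l) (D <+> D')) (S \<times> UNIV)"
  proof (rule alg_indep_insert[where S' = "S \<times> UNIV" and f = ?F])
    fix b c j y
    assume rel: "\<And>y. y \<in> S \<times> UNIV \<Longrightarrow>
        (\<Sum>j\<le>b. (\<Sum>\<alpha>\<in>(D <+> D') \<rightarrow>\<^sub>E {..b}. c j \<alpha> * mon (D <+> D') \<alpha> (\<lambda>k. ?F k y)) * ?F (Inr l) y ^ j) = 0"
      and j: "j \<le> b" and y: "y \<in> S \<times> (UNIV :: ('l \<Rightarrow> 'a) set)"
    obtain x t where xt: "y = (x, t)" "x \<in> S" using y by auto
    define h where "h j = (\<Sum>\<alpha>\<in>(D <+> D') \<rightarrow>\<^sub>E {..b}. c j \<alpha> * mon (D <+> D') \<alpha> (\<lambda>k. ?F k (x, t)))" for j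
    have "mon (D <+> D') \<alpha> (\<lambda>k. ?F k (x, t(l := s))) = mon (D <+> D') \<alpha> (\<lambda>k. ?F k (x, t))" for s \<alpha>
      unfolding mon_def using insert.hyps(2) by (intro prod.cong) auto
    then have "(\<Sum>j\<le>b. h j * s ^ j) = 0" for s
      using rel[of "(x, t(l := s))"] xt by (simp add: h_def)
    then have "poly (\<Sum>j\<le>b. monom (h j) j) s = 0" for s
      by (simp add: poly_sum poly_monom)
    then have "(\<Sum>j\<le>b. monom (h j) j) = 0"
      using poly_eq_0_if_vanishing[OF inf] by blast
    then have "coeff (\<Sum>j\<le>b. monom (h j) j) j = 0" by simp
    then show "(\<Sum>\<alpha>\<in>(D <+> D') \<rightarrow>\<^sub>E {..b}. c j \<alpha> * mon (D <+> D') \<alpha> (\<lambda>k. ?F k y)) = 0"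
      using j by (simp add: coeff_sum h_def xt)
  next
    show "finite (D <+> D')" "Inr l \<notin> D <+> D'" using insert.hyps assms(2) by auto
    show "alg_indep ?F (D <+> D') (S \<times> UNIV)" by (rule insert.IH)
  qed
  moreover have "insert (Inr l) (D <+> D') = D <+> insert l D'" by auto
  ultimately show ?case by simp
qed

text \<open>The power products with exponents up to \<open>b\<close> are linearly independent on
  \<open>S\<close>, yet they all lie in the span of the monomials in \<open>G\<close>. If they
  outnumbered \<open>G\<close>, a homogeneous linear system would yield a relation among
  them.\<close>

lemma alg_indep_card_le:
  fixes f :: "'k \<Rightarrow> ('v \<Rightarrow> 'a::field) \<Rightarrow> 'a"
  assumes "finite J" "finite D" "alg_indep f D S"
    and "\<And>k. k \<in> D \<Longrightarrow> polyfun J q (f k)"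
    and "finite G" "\<And>\<alpha> z. \<alpha> \<in> exponents J (card D * b * q) \<Longrightarrow> z \<in> S \<Longrightarrow>
      mon J \<alpha> z = (\<Sum>\<beta>\<in>G. \<gamma> \<alpha> \<beta> * mon J \<beta> z)"
  shows "(b + 1) ^ card D \<le> card G"
proof (rule ccontr)
  assume "\<not> ?thesis"
  moreover define E where "E = D \<rightarrow>\<^sub>E {..b}"
  ultimately have card: "card G < card E" using assms(2) by (simp add: card_PiE)
  have "finite E" unfolding E_def using assms(2) by (intro finite_PiE) auto
  have "\<exists>\<beta>. \<forall>z\<in>S. mon D \<alpha> (\<lambda>k. f k z) = (\<Sum>g\<in>G. \<beta> g * mon J g z)" if \<alpha>: "\<alpha> \<in> E" for \<alpha>
  proof -
    have "polyfun J (card D * b * q) (\<lambda>z. mon D \<alpha> (\<lambda>k. f k z))"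
      using assms(1,2,4) \<alpha> unfolding E_def by (rule polyfun_power_product)
    from polyfun_expand[OF this] obtain c where
      c: "\<And>z. mon D \<alpha> (\<lambda>k. f k z) = (\<Sum>\<delta>\<in>exponents J (card D * b * q). c \<delta> * mon J \<delta> z)"
      by auto
    show ?thesis
    proof (intro exI ballI)
      fix z assume "z \<in> S"
      then have "mon D \<alpha> (\<lambda>k. f k z) =
          (\<Sum>\<delta>\<in>exponents J (card D * b * q). \<Sum>g\<in>G. c \<delta> * \<gamma> \<delta> g * mon J g z)"
        unfolding c
        by (intro sum.cong refl, subst assms(6)) (simp_all add: sum_distrib_left mult.assoc)
      also have "\<dots> = (\<Sum>g\<in>G. (\<Sum>\<delta>\<in>exponents J (card D * b * q). c \<delta> * \<gamma> \<delta> g) * mon J g z)"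
        by (subst sum.swap) (simp add: sum_distrib_right)
      finally show "mon D \<alpha> (\<lambda>k. f k z) =
          (\<Sum>g\<in>G. (\<Sum>\<delta>\<in>exponents J (card D * b * q). c \<delta> * \<gamma> \<delta> g) * mon J g z)" .
    qed
  qed
  then obtain \<beta> where \<beta>: "\<And>\<alpha> z. \<alpha> \<in> E \<Longrightarrow> z \<in> S \<Longrightarrow>
      mon D \<alpha> (\<lambda>k. f k z) = (\<Sum>g\<in>G. \<beta> \<alpha> g * mon J g z)"
    by metis
  obtain c \<alpha> where c: "\<alpha> \<in> E" "c \<alpha> \<noteq> 0" "\<forall>g\<in>G. (\<Sum>\<alpha>\<in>E. c \<alpha> * \<beta> \<alpha> g) = 0"
    using homogeneous_system_nontrivial_solution[OF assms(5) \<open>finite E\<close> card, of \<beta>] by blast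
  have "c \<alpha> = 0"
  proof (rule alg_indepD[OF assms(3)])
    fix z assume "z \<in> S"
    then have "(\<Sum>\<alpha>\<in>E. c \<alpha> * mon D \<alpha> (\<lambda>k. f k z)) = (\<Sum>\<alpha>\<in>E. \<Sum>g\<in>G. c \<alpha> * \<beta> \<alpha> g * mon J g z)"
      by (intro sum.cong) (simp_all add: \<beta> sum_distrib_left mult.assoc)
    also have "\<dots> = (\<Sum>g\<in>G. (\<Sum>\<alpha>\<in>E. c \<alpha> * \<beta> \<alpha> g) * mon J g z)"
      by (subst sum.swap) (simp add: sum_distrib_right)
    also have "\<dots> = 0" using c(3) by simp
    finally show "(\<Sum>\<alpha>\<in>D \<rightarrow>\<^sub>E {..b}. c \<alpha> * mon D \<alpha> (\<lambda>k. f k z)) = 0" unfolding E_def .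
  qed (use c in \<open>simp add: E_def\<close>)
  then show False using c(2) by simp
qed

section \<open>Degenerations to the unit tensor\<close>

definition laurent_eval :: "'a::field \<Rightarrow> 'a laurent_poly \<Rightarrow> 'a" where
  "laurent_eval \<epsilon> p = (\<Sum>k\<in>Poly_Mapping.keys p. Poly_Mapping.lookup p k * \<epsilon> powi k)"

lemma laurent_eval_superset:
  assumes "finite S" "Poly_Mapping.keys p \<subseteq> S"
  shows "laurent_eval \<epsilon> p = (\<Sum>k\<in>S. Poly_Mapping.lookup p k * \<epsilon> powi k)"
  unfolding laurent_eval_def
  by (rule sum.mono_neutral_left) (use assms in \<open>auto simp: in_keys_iff\<close>)

lemma laurent_eval_single: "laurent_eval \<epsilon> (Poly_Mapping.single k c) = c * \<epsilon> powi k"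
  by (subst laurent_eval_superset[of "{k}"]) auto

lemma laurent_eval_0 [simp]: "laurent_eval \<epsilon> 0 = 0"
  by (simp add: laurent_eval_def)

lemma laurent_eval_add: "laurent_eval \<epsilon> (p + q) = laurent_eval \<epsilon> p + laurent_eval \<epsilon> q"
  using Poly_Mapping.keys_add[of p q]
  by (simp add: laurent_eval_superset[of "Poly_Mapping.keys p \<union> Poly_Mapping.keys q"]
      lookup_add distrib_right sum.distrib)

lemma laurent_eval_sum: "laurent_eval \<epsilon> (\<Sum>x\<in>X. p x) = (\<Sum>x\<in>X. laurent_eval \<epsilon> (p x))"
  by (induction X rule: infinite_finite_induct) (auto simp: laurent_eval_add)

lemma poly_mapping_eq_sum_single:
  "p = (\<Sum>k\<in>Poly_Mapping.keys p. Poly_Mapping.single k (Poly_Mapping.lookup p k))"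
  by (rule poly_mapping_eqI) (simp add: lookup_sum lookup_single when_def in_keys_iff)

text \<open>Expansion into single terms; the exponent law of \<open>powi\<close> is what requires
  \<epsilon> to be nonzero.\<close>

lemma laurent_eval_mult:
  assumes "\<epsilon> \<noteq> 0"
  shows "laurent_eval \<epsilon> (p * q) = laurent_eval \<epsilon> p * laurent_eval \<epsilon> q"
proof -
  have "p * q = (\<Sum>k\<in>Poly_Mapping.keys p. \<Sum>l\<in>Poly_Mapping.keys q.
      Poly_Mapping.single (k + l) (Poly_Mapping.lookup p k * Poly_Mapping.lookup q l))"
    using arg_cong2[OF poly_mapping_eq_sum_single[of p] poly_mapping_eq_sum_single[of q], of "(*)"]
    by (simp add: sum_product mult_single)
  then have "laurent_eval \<epsilon> (p * q) = (\<Sum>k\<in>Poly_Mapping.keys p. \<Sum>l\<in>Poly_Mapping.keys q.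
      (Poly_Mapping.lookup p k * \<epsilon> powi k) * (Poly_Mapping.lookup q l * \<epsilon> powi l))"
    using assms by (simp add: laurent_eval_sum laurent_eval_single power_int_add mult_ac)
  then show ?thesis unfolding laurent_eval_def by (simp add: sum_product)
qed

lemma laurent_clear_denominators:
  assumes "finite X"
  shows "\<exists>t P. \<forall>x\<in>X. \<forall>\<epsilon>. \<epsilon> \<noteq> 0 \<longrightarrow> poly (P x) \<epsilon> = \<epsilon> ^ t * laurent_eval \<epsilon> (A x)"
proof -
  \<comment> \<open>The sum of all negative exponents in absolute value, a crude bound for each of
    them.\<close>
  define t where "t = (\<Sum>x\<in>X. \<Sum>k\<in>Poly_Mapping.keys (A x). nat (- k))"
  define P where "P x = (\<Sum>k\<in>Poly_Mapping.keys (A x). monom (Poly_Mapping.lookup (A x) k) (nat (k + int t)))" for x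
  have "poly (P x) \<epsilon> = \<epsilon> ^ t * laurent_eval \<epsilon> (A x)" if x: "x \<in> X" and \<epsilon>: "\<epsilon> \<noteq> 0" for x \<epsilon>
  proof -
    have "\<epsilon> ^ nat (k + int t) = \<epsilon> ^ t * \<epsilon> powi k" if k: "k \<in> Poly_Mapping.keys (A x)" for k
    proof -
      have "nat (- k) \<le> (\<Sum>k\<in>Poly_Mapping.keys (A x). nat (- k))"
        using k by (intro member_le_sum) auto
      also have "\<dots> \<le> t" unfolding t_def using x assms by (intro member_le_sum) auto
      finally have "k + int t \<ge> 0" by linarith
      then have "\<epsilon> ^ nat (k + int t) = \<epsilon> powi (k + int t)" by (simp add: power_int_def)
      then show ?thesis using \<epsilon> by (simp add: power_int_add)
    qed
    then show ?thesis
      unfolding P_def laurent_eval_def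
      by (simp add: poly_sum poly_monom sum_distrib_left mult_ac)
  qed
  then show ?thesis by blast
qed

lemma laurent_matrix_clear_denominators:
  fixes A :: "nat \<Rightarrow> 'x \<Rightarrow> 'a::field laurent_poly"
  assumes "finite X"
  shows "\<exists>t P. \<forall>i<n. \<forall>x\<in>X. \<forall>\<epsilon>. \<epsilon> \<noteq> 0 \<longrightarrow> poly (P i x) \<epsilon> = \<epsilon> ^ t * laurent_eval \<epsilon> (A i x)"
proof -
  have "finite ({..<n} \<times> X)" using assms by auto
  from laurent_clear_denominators[OF this, of "\<lambda>(i, x). A i x"] obtain t P where
    "\<forall>y\<in>{..<n} \<times> X. \<forall>\<epsilon>. \<epsilon> \<noteq> 0 \<longrightarrow> poly (P y) \<epsilon> = \<epsilon> ^ t * laurent_eval \<epsilon> (case y of (i, x) \<Rightarrow> A i x)"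
    by blast
  then show ?thesis by (intro exI[of _ t] exI[of _ "\<lambda>i x. P (i, x)"]) force
qed

text \<open>Clearing the poles of the three matrices multiplies both sides by a power of \<epsilon>.
  The higher tensors have exponents at least 1, so they keep one factor \<epsilon> and are collected
  in \<open>R\<close>.\<close>

lemma degenerates_to_unit_tensorD:
  fixes T :: "('i, 'j, 'k, 'a::field) tensor"
  assumes "(unit_tensor n :: (nat, nat, nat, 'a) tensor) \<unlhd> T"
    and "finite (idx1 T)" "finite (idx2 T)" "finite (idx3 T)"
  shows "\<exists>t A B C R. \<forall>\<epsilon> i j k. \<epsilon> \<noteq> 0 \<longrightarrow> i < n \<longrightarrow> j < n \<longrightarrow> k < n \<longrightarrow>
      (\<Sum>a\<in>idx1 T. \<Sum>b\<in>idx2 T. \<Sum>c\<in>idx3 T.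
        poly (A i a) \<epsilon> * poly (B j b) \<epsilon> * poly (C k c) \<epsilon> * entry T a b c) =
      \<epsilon> ^ t * ((if i = j \<and> j = k then 1 else 0) + \<epsilon> * poly (R i j k) \<epsilon>)"
proof -
  obtain e' R A B C where deg: "\<forall>i\<in>{..<n}. \<forall>j\<in>{..<n}. \<forall>k\<in>{..<n}.
      Poly_Mapping.single 0 (if i = j \<and> j = k then 1 else 0)
        + (\<Sum>q=1..e'. Poly_Mapping.single (int q) (R q i j k))
      = tensor_act A B C (to_laurent T) i j k"
    using assms(1) unfolding degenerates_to_def unit_tensor_def by auto
  obtain tA A' where "\<forall>i<n. \<forall>a\<in>idx1 T. \<forall>\<epsilon>. \<epsilon> \<noteq> 0 \<longrightarrow>
      poly (A' i a) \<epsilon> = \<epsilon> ^ tA * laurent_eval \<epsilon> (A i a)"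
    using laurent_matrix_clear_denominators[OF assms(2)] by blast
  note A' = this[rule_format]
  obtain tB B' where "\<forall>i<n. \<forall>a\<in>idx2 T. \<forall>\<epsilon>. \<epsilon> \<noteq> 0 \<longrightarrow>
      poly (B' i a) \<epsilon> = \<epsilon> ^ tB * laurent_eval \<epsilon> (B i a)"
    using laurent_matrix_clear_denominators[OF assms(3)] by blast
  note B' = this[rule_format]
  obtain tC C' where "\<forall>i<n. \<forall>a\<in>idx3 T. \<forall>\<epsilon>. \<epsilon> \<noteq> 0 \<longrightarrow>
      poly (C' i a) \<epsilon> = \<epsilon> ^ tC * laurent_eval \<epsilon> (C i a)"
    using laurent_matrix_clear_denominators[OF assms(4)] by blast
  note C' = this[rule_format]
  show ?thesis
  proof (intro exI allI impI)
    fix \<epsilon> :: 'a and i j k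
    assume \<epsilon>: "\<epsilon> \<noteq> 0" and ijk: "i < n" "j < n" "k < n"
    have "(\<Sum>a\<in>idx1 T. \<Sum>b\<in>idx2 T. \<Sum>c\<in>idx3 T.
        poly (A' i a) \<epsilon> * poly (B' j b) \<epsilon> * poly (C' k c) \<epsilon> * entry T a b c) =
      \<epsilon> ^ (tA + tB + tC) * (\<Sum>a\<in>idx1 T. \<Sum>b\<in>idx2 T. \<Sum>c\<in>idx3 T.
        laurent_eval \<epsilon> (A i a) * laurent_eval \<epsilon> (B j b) * laurent_eval \<epsilon> (C k c) * entry T a b c)"
      unfolding sum_distrib_left
      by (intro sum.cong refl) (simp add: A' B' C' \<epsilon> ijk power_add)
    also have "(\<Sum>a\<in>idx1 T. \<Sum>b\<in>idx2 T. \<Sum>c\<in>idx3 T.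
        laurent_eval \<epsilon> (A i a) * laurent_eval \<epsilon> (B j b) * laurent_eval \<epsilon> (C k c) * entry T a b c)
        = laurent_eval \<epsilon> (tensor_act A B C (to_laurent T) i j k)"
      unfolding tensor_act_def to_laurent_def
      by (simp add: laurent_eval_sum laurent_eval_mult \<epsilon> laurent_eval_single)
    also have "\<dots> = (if i = j \<and> j = k then 1 else 0) + (\<Sum>q=1..e'. R q i j k * \<epsilon> ^ q)"
      using deg[rule_format, of i j k, symmetric] ijk
      by (simp add: laurent_eval_add laurent_eval_sum laurent_eval_single)
    also have "(\<Sum>q=1..e'. R q i j k * \<epsilon> ^ q) = \<epsilon> * poly (\<Sum>q=1..e'. monom (R q i j k) (q - 1)) \<epsilon>"
      unfolding poly_sum sum_distrib_left poly_monom
      by (intro sum.cong refl) (simp add: mult_ac power_eq_if)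
    finally show "(\<Sum>a\<in>idx1 T. \<Sum>b\<in>idx2 T. \<Sum>c\<in>idx3 T.
        poly (A' i a) \<epsilon> * poly (B' j b) \<epsilon> * poly (C' k c) \<epsilon> * entry T a b c) =
      \<epsilon> ^ (tA + tB + tC) * ((if i = j \<and> j = k then 1 else 0) +
        \<epsilon> * poly (\<Sum>q=1..e'. monom (R q i j k) (q - 1)) \<epsilon>)" .
  qed
qed

section \<open>The border subrank is bounded by the codimension of the kernel variety\<close>

text \<open>The standard monomials of degree at most \<open>q\<close> modulo the ideal generated by
  the products of the pairs \<open>u k\<close>, \<open>v k\<close>.\<close>

definition monomials_avoiding_pairs :: "'v set \<Rightarrow> nat \<Rightarrow> nat \<Rightarrow> (nat \<Rightarrow> 'v) \<Rightarrow> (nat \<Rightarrow> 'v) \<Rightarrow> ('v \<Rightarrow> nat) set" where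
  "monomials_avoiding_pairs J q n u v =
     {\<beta> \<in> exponents J q. \<forall>k<n. \<beta> (u k) = 0 \<or> \<beta> (v k) = 0}"

text \<open>If \<open>u k\<close> and \<open>v k\<close> divide a monomial, equation
  \<open>k\<close> times the cofactor expresses it as \<epsilon> times a polynomial. The degree
  stays at most \<open>q\<close> because \<open>\<Psi> k\<close> has degree 2, like the product it
  replaces. All these equations form a linear system in the monomials that is the identity on the
  divisible ones at \<epsilon> = 0.\<close>

lemma monomials_avoiding_pairs_span:
  fixes \<Psi> :: "nat \<Rightarrow> 'a::field \<Rightarrow> ('v \<Rightarrow> 'a) \<Rightarrow> 'a"
  assumes J: "finite J" and uv: "\<And>k. k < n \<Longrightarrow> u k \<in> J \<and> v k \<in> J \<and> u k \<noteq> v k"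
    and \<Psi>: "\<And>k. k < n \<Longrightarrow> polyfam J 2 (\<Psi> k)"
  shows "\<exists>E. finite E \<and> (\<forall>\<epsilon>. \<epsilon> \<notin> E \<longrightarrow> (\<exists>\<gamma>. \<forall>z.
           (\<forall>k<n. z (u k) * z (v k) + \<epsilon> * \<Psi> k \<epsilon> z = 0) \<longrightarrow>
           (\<forall>\<alpha>\<in>exponents J q. mon J \<alpha> z =
              (\<Sum>\<beta>\<in>monomials_avoiding_pairs J q n u v. \<gamma> \<alpha> \<beta> * mon J \<beta> z))))"
proof -
  let ?M = "monomials_avoiding_pairs J q n u v"
  let ?X = "exponents J q"
  have fX: "finite ?X" using finite_exponents[OF J] .
  have MX: "?M \<subseteq> ?X" by (auto simp: monomials_avoiding_pairs_def)
  have "\<exists>c. \<forall>\<epsilon> z. (\<forall>k<n. z (u k) * z (v k) + \<epsilon> * \<Psi> k \<epsilon> z = 0) \<longrightarrow>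
      mon J m z + \<epsilon> * (\<Sum>\<alpha>\<in>?X. poly (c \<alpha>) \<epsilon> * mon J \<alpha> z) = 0" if m: "m \<in> ?X - ?M" for m
  proof -
    obtain k where k: "k < n" "m (u k) \<noteq> 0" "m (v k) \<noteq> 0"
      using m by (auto simp: monomials_avoiding_pairs_def)
    define m' where "m' = m(u k := m (u k) - 1, v k := m (v k) - 1)"
    define J' where "J' = J - {u k, v k}"
    have J': "J = insert (u k) (insert (v k) J')" "finite J'" "u k \<notin> insert (v k) J'" "v k \<notin> J'"
      using uv[OF k(1)] J unfolding J'_def by auto
    have same: "m' j = m j" if "j \<in> J'" for j using that J' unfolding m'_def by auto
    have "sum m J = 2 + sum m' J"
      unfolding J'(1) using J'(2-4) same k uv[OF k(1)] by (simp add: m'_def)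
    moreover have "m' \<in> J \<rightarrow>\<^sub>E UNIV"
      using m uv[OF k(1)] by (auto simp: m'_def exponents_def PiE_def extensional_def)
    \<comment> \<open>Both factors occur in \<open>m\<close>, so \<open>q\<close> is at least 2 and
      the truncated subtraction is exact.\<close>
    ultimately have m': "m' \<in> exponents J (q - 2)" "q - 2 + 2 = q"
      using m by (auto simp: exponents_def)
    have mon: "mon J m z = mon J m' z * (z (u k) * z (v k))" for z :: "'v \<Rightarrow> 'a"
    proof -
      have "z (u k) ^ m (u k) = z (u k) ^ m' (u k) * z (u k)" "z (v k) ^ m (v k) = z (v k) ^ m' (v k) * z (v k)"
        using k uv[OF k(1)] by (simp_all add: m'_def power_eq_if)
      moreover have "(\<Prod>j\<in>J'. z j ^ m j) = (\<Prod>j\<in>J'. z j ^ m' j)"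
        by (intro prod.cong refl) (simp add: same)
      ultimately show ?thesis
        unfolding mon_def J'(1) using J'(2-4) by (simp add: mult_ac)
    qed
    have "polyfam J q (\<lambda>\<epsilon> z. mon J m' z * \<Psi> k \<epsilon> z)"
      using polyfam_mult[OF J polyfam_mon[OF J m'(1)] \<Psi>[OF k(1)]] m'(2) by simp
    then obtain c where c: "\<And>\<epsilon> z. mon J m' z * \<Psi> k \<epsilon> z = (\<Sum>\<alpha>\<in>?X. poly (c \<alpha>) \<epsilon> * mon J \<alpha> z)"
      unfolding polyfam_def by blast
    have "mon J m z + \<epsilon> * (\<Sum>\<alpha>\<in>?X. poly (c \<alpha>) \<epsilon> * mon J \<alpha> z) =
        mon J m' z * (z (u k) * z (v k) + \<epsilon> * \<Psi> k \<epsilon> z)" for \<epsilon> z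
      unfolding c[symmetric] mon by (simp add: algebra_simps)
    then show ?thesis using k(1) by (intro exI[of _ c]) simp
  qed
  then have "\<forall>m\<in>?X - ?M. \<exists>c. \<forall>\<epsilon> z. (\<forall>k<n. z (u k) * z (v k) + \<epsilon> * \<Psi> k \<epsilon> z = 0) \<longrightarrow>
      mon J m z + \<epsilon> * (\<Sum>\<alpha>\<in>?X. poly (c \<alpha>) \<epsilon> * mon J \<alpha> z) = 0"
    by (rule ballI)
  from bchoice[OF this] obtain c where
    "\<forall>m\<in>?X - ?M. \<forall>\<epsilon> z. (\<forall>k<n. z (u k) * z (v k) + \<epsilon> * \<Psi> k \<epsilon> z = 0) \<longrightarrow>
      mon J m z + \<epsilon> * (\<Sum>\<alpha>\<in>?X. poly (c m \<alpha>) \<epsilon> * mon J \<alpha> z) = 0"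
    by (rule exE)
  then have c: "mon J m z + \<epsilon> * (\<Sum>\<alpha>\<in>?X. poly (c m \<alpha>) \<epsilon> * mon J \<alpha> z) = 0"
    if "m \<in> ?X - ?M" "\<forall>k<n. z (u k) * z (v k) + \<epsilon> * \<Psi> k \<epsilon> z = 0" for m \<epsilon> z
    using that by simp
  define G where "G m s = (if m = s then 1 else 0) + monom 1 1 * c m s" for m s
  have "\<exists>E. finite E \<and> (\<forall>\<epsilon>. \<epsilon> \<notin> E \<longrightarrow> (\<exists>\<gamma>. \<forall>h.
           (\<forall>m\<in>?X - ?M. (\<Sum>s\<in>?X. poly (G m s) \<epsilon> * h s) = 0) \<longrightarrow>
           (\<forall>m\<in>?X - ?M. h m = (\<Sum>s\<in>?X - (?X - ?M). \<gamma> m s * h s))))"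
    by (rule perturbed_identity_eliminate[OF fX]) (auto simp: G_def poly_monom)
  then obtain E where E: "finite E" "\<And>\<epsilon>. \<epsilon> \<notin> E \<Longrightarrow> \<exists>\<gamma>. \<forall>h.
           (\<forall>m\<in>?X - ?M. (\<Sum>s\<in>?X. poly (G m s) \<epsilon> * h s) = 0) \<longrightarrow>
           (\<forall>m\<in>?X - ?M. h m = (\<Sum>s\<in>?X - (?X - ?M). \<gamma> m s * h s))"
    by blast
  have "\<exists>\<gamma>. \<forall>z. (\<forall>k<n. z (u k) * z (v k) + \<epsilon> * \<Psi> k \<epsilon> z = 0) \<longrightarrow>
           (\<forall>\<alpha>\<in>?X. mon J \<alpha> z = (\<Sum>\<beta>\<in>?M. \<gamma> \<alpha> \<beta> * mon J \<beta> z))" if \<epsilon>: "\<epsilon> \<notin> E" for \<epsilon>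
  proof -
    have "?X - (?X - ?M) = ?M" using MX by blast
    then obtain \<gamma> where \<gamma>: "\<And>h. (\<forall>m\<in>?X - ?M. (\<Sum>s\<in>?X. poly (G m s) \<epsilon> * h s) = 0) \<Longrightarrow>
           (\<forall>m\<in>?X - ?M. h m = (\<Sum>s\<in>?M. \<gamma> m s * h s))"
      using E(2)[OF \<epsilon>] by auto
    \<comment> \<open>A monomial that already avoids the pairs is its own expansion, hence the
      Kronecker delta.\<close>
    have "mon J \<alpha> z = (\<Sum>\<beta>\<in>?M. (if \<alpha> \<in> ?M then (if \<alpha> = \<beta> then 1 else 0) else \<gamma> \<alpha> \<beta>) * mon J \<beta> z)"
      if z: "\<forall>k<n. z (u k) * z (v k) + \<epsilon> * \<Psi> k \<epsilon> z = 0" and \<alpha>: "\<alpha> \<in> ?X" for z \<alpha>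
    proof (cases "\<alpha> \<in> ?M")
      case True
      have "(\<Sum>\<beta>\<in>?M. (if \<alpha> = \<beta> then 1 else 0) * mon J \<beta> z) = (\<Sum>\<beta>\<in>?M. if \<alpha> = \<beta> then mon J \<beta> z else 0)"
        by (intro sum.cong) auto
      then show ?thesis using True finite_subset[OF MX fX] by simp
    next
      case False
      have "(\<Sum>s\<in>?X. poly (G m s) \<epsilon> * mon J s z) = 0" if m: "m \<in> ?X - ?M" for m
      proof -
        have "(\<Sum>s\<in>?X. poly (G m s) \<epsilon> * mon J s z) =
            (\<Sum>s\<in>?X. (if m = s then mon J s z else 0) + \<epsilon> * (poly (c m s) \<epsilon> * mon J s z))"
          unfolding G_def by (intro sum.cong) (auto simp: poly_monom algebra_simps)
        also have "\<dots> = mon J m z + \<epsilon> * (\<Sum>s\<in>?X. poly (c m s) \<epsilon> * mon J s z)"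
          using fX m by (simp add: sum.distrib sum_distrib_left)
        finally show ?thesis using c[OF m z] by simp
      qed
      then show ?thesis using \<gamma>[of "\<lambda>s. mon J s z"] \<alpha> False by auto
    qed
    then show ?thesis
      by (intro exI[of _ "\<lambda>\<alpha> \<beta>. if \<alpha> \<in> ?M then (if \<alpha> = \<beta> then 1 else 0) else \<gamma> \<alpha> \<beta>"]) simp
  qed
  then show ?thesis using E(1) by (intro exI[of _ E]) simp
qed

text \<open>One exponent of each pair is 0, so their sum together with one bit determines both. Each
  pair thus contributes one free exponent instead of two, which lowers the growth from
  \<open>2 * n + card I\<close> to \<open>n + card I\<close>.\<close>

lemma card_monomials_avoiding_pairs:
  fixes I :: "'v set"
  defines "u \<equiv> \<lambda>k :: nat. Inl (Inl k) :: (nat + nat) + 'v" and "v \<equiv> \<lambda>k :: nat. Inl (Inr k) :: (nat + nat) + 'v"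
  assumes "finite I"
  shows "card (monomials_avoiding_pairs (({..<n} <+> {..<n}) <+> I) q n u v) \<le> 2 ^ n * (q + 1) ^ (n + card I)"
proof -
  let ?J = "({..<n} <+> {..<n}) <+> I"
  let ?M = "monomials_avoiding_pairs ?J q n u v"
  define h where "h \<beta> = ({k. k < n \<and> \<beta> (u k) = 0},
      \<lambda>x\<in>{..<n} <+> I. case x of Inl k \<Rightarrow> \<beta> (u k) + \<beta> (v k) | Inr i \<Rightarrow> \<beta> (Inr i))" for \<beta> :: "(nat + nat) + 'v \<Rightarrow> nat"
  have J: "finite ?J" using assms(3) by auto
  have "inj_on h ?M"
  proof (rule inj_onI)
    fix \<alpha> \<beta> assume \<alpha>: "\<alpha> \<in> ?M" and \<beta>: "\<beta> \<in> ?M" and eq: "h \<alpha> = h \<beta>"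
    have z: "\<alpha> (u k) = 0 \<longleftrightarrow> \<beta> (u k) = 0" if "k < n" for k
      using eq that unfolding h_def by auto
    have s: "\<alpha> (u k) + \<alpha> (v k) = \<beta> (u k) + \<beta> (v k)" if "k < n" for k
      using fun_cong[OF arg_cong[OF eq, of snd], of "Inl k"] that unfolding h_def by auto
    have i: "\<alpha> (Inr i) = \<beta> (Inr i)" if "i \<in> I" for i
      using fun_cong[OF arg_cong[OF eq, of snd], of "Inr i"] that unfolding h_def by auto
    have uv: "\<alpha> (u k) = \<beta> (u k) \<and> \<alpha> (v k) = \<beta> (v k)" if "k < n" for k
      using z[OF that] s[OF that] that \<alpha> \<beta> unfolding monomials_avoiding_pairs_def by fastforce
    show "\<alpha> = \<beta>"
    proof (rule PiE_ext[where k = ?J])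
      show "\<alpha> \<in> ?J \<rightarrow>\<^sub>E UNIV" "\<beta> \<in> ?J \<rightarrow>\<^sub>E UNIV"
        using \<alpha> \<beta> unfolding monomials_avoiding_pairs_def exponents_def by auto
    qed (use uv i in \<open>auto simp: u_def v_def\<close>)
  qed
  moreover have "h ` ?M \<subseteq> Pow {..<n} \<times> (({..<n} <+> I) \<rightarrow>\<^sub>E {..q})"
  proof
    fix y assume "y \<in> h ` ?M"
    then obtain \<beta> where \<beta>: "\<beta> \<in> ?M" "y = h \<beta>" by blast
    have "\<beta> j \<le> q" if "j \<in> ?J" for j
      using exponents_le[OF J _ that] \<beta>(1) unfolding monomials_avoiding_pairs_def by auto
    then show "y \<in> Pow {..<n} \<times> (({..<n} <+> I) \<rightarrow>\<^sub>E {..q})"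
      using \<beta>(1) unfolding \<beta>(2) h_def monomials_avoiding_pairs_def
      by (auto simp: u_def v_def split: sum.split)
  qed
  ultimately have "card ?M \<le> card (Pow {..<n} \<times> (({..<n} <+> I) \<rightarrow>\<^sub>E {..q}))"
    using assms(3) by (intro card_inj_on_le) (auto intro!: finite_PiE)
  then show ?thesis
    using assms(3) by (simp add: card_cartesian_product card_Pow card_PiE card_Plus)
qed

section \<open>Pulling back the kernel equations along a degeneration\<close>

lemma kernel_varietyD:
  assumes "x \<in> kernel_variety T" "c \<in> idx3 T" "finite (idx3 T)"
  shows "(\<Sum>a\<in>idx1 T. \<Sum>b\<in>idx2 T. entry T a b c * x (Inl a) * x (Inr b)) = 0"
proof -
  have "(\<Sum>k\<in>idx3 T. entry T a b k * x (Inl a) * x (Inr b) * std_basis c k) =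
      entry T a b c * x (Inl a) * x (Inr b)" for a b
    using assms(2,3) by (simp add: std_basis_def if_distrib[of "\<lambda>y. _ * y"] cong: if_cong)
  moreover have "trilinear_form T (x \<circ> Inl) (x \<circ> Inr) (std_basis c) = 0"
    using assms(1,2) unfolding kernel_variety_def by blast
  ultimately show ?thesis by (simp add: trilinear_form_def)
qed

text \<open>
  The substitution \<open>x = (A(\<epsilon>) u, B(\<epsilon>) v) + \<epsilon>^(t + 1) w\<close>. It is surjective for \<open>\<epsilon> \<noteq> 0\<close> even with
  \<open>u, v\<close> prescribed, and it pulls the equations of the kernel variety back to perturbations of
  \<open>u k * v k = 0\<close>.
\<close>

lemma degeneration_substitution:
  fixes T :: "('i, 'j, 'k, 'a::field) tensor" and n :: nat
  defines "I \<equiv> idx1 T <+> idx2 T"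
  defines "J \<equiv> ({..<n} <+> {..<n}) <+> I"
  assumes "(unit_tensor n :: (nat, nat, nat, 'a) tensor) \<unlhd> T"
    and fin: "finite (idx1 T)" "finite (idx2 T)" "finite (idx3 T)"
  shows "\<exists>(L :: 'a \<Rightarrow> ((nat + nat) + ('i + 'j) \<Rightarrow> 'a) \<Rightarrow> 'i + 'j \<Rightarrow> 'a) \<Psi>.
    (\<forall>v\<in>I. polyfam J 1 (\<lambda>\<epsilon> z. L \<epsilon> z v)) \<and>
    (\<forall>k<n. polyfam J 2 (\<Psi> k)) \<and>
    (\<forall>\<epsilon> x s. \<epsilon> \<noteq> 0 \<longrightarrow> x \<in> affine_space I \<longrightarrow> (\<exists>z. L \<epsilon> z = x \<and> (\<forall>l. z (Inl l) = s l))) \<and>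
    (\<forall>\<epsilon> z. \<forall>k<n. \<epsilon> \<noteq> 0 \<longrightarrow> L \<epsilon> z \<in> kernel_variety T \<longrightarrow>
      z (Inl (Inl k)) * z (Inl (Inr k)) + \<epsilon> * \<Psi> k \<epsilon> z = 0)"
proof -
  obtain t A B C R where "\<forall>\<epsilon> i j k. \<epsilon> \<noteq> 0 \<longrightarrow> i < n \<longrightarrow> j < n \<longrightarrow> k < n \<longrightarrow>
      (\<Sum>a\<in>idx1 T. \<Sum>b\<in>idx2 T. \<Sum>c\<in>idx3 T.
        poly (A i a) \<epsilon> * poly (B j b) \<epsilon> * poly (C k c) \<epsilon> * entry T a b c) =
      \<epsilon> ^ t * ((if i = j \<and> j = k then 1 else 0) + \<epsilon> * poly (R i j k) \<epsilon>)"
    using degenerates_to_unit_tensorD[OF assms(3) fin] by (elim exE) blast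
  note deg = this[rule_format]
  have J: "finite J" unfolding J_def I_def using fin by auto
  define P where "P = idx1 T \<times> idx2 T \<times> idx3 T"
  define N2 where "N2 = {..<n} \<times> {..<n}"
  define La where "La \<epsilon> z a = (\<Sum>p<n. poly (A p a) \<epsilon> * z (Inl (Inl p)))"
    for \<epsilon> and z :: "(nat + nat) + ('i + 'j) \<Rightarrow> 'a" and a
  define Lb where "Lb \<epsilon> z b = (\<Sum>p<n. poly (B p b) \<epsilon> * z (Inl (Inr p)))"
    for \<epsilon> and z :: "(nat + nat) + ('i + 'j) \<Rightarrow> 'a" and b
  \<comment> \<open>The terms of \<open>L \<epsilon> z (Inl a) * L \<epsilon> z (Inr b)\<close> that
    involve w, divided by \<epsilon>^(t + 1). The exponent exceeds by one the power \<epsilon>^t to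
    be cancelled, so these terms end up with a factor \<epsilon>.\<close>
  define X where "X a b \<epsilon> z = La \<epsilon> z a * z (Inr (Inr b)) + z (Inr (Inl a)) * Lb \<epsilon> z b
      + poly (monom 1 (t + 1)) \<epsilon> * (z (Inr (Inl a)) * z (Inr (Inr b)))"
    for a b \<epsilon> and z :: "(nat + nat) + ('i + 'j) \<Rightarrow> 'a"
  define L where "L \<epsilon> z = (\<lambda>v\<in>I. (case v of Inl a \<Rightarrow> La \<epsilon> z a | Inr b \<Rightarrow> Lb \<epsilon> z b)
      + poly (monom 1 (t + 1)) \<epsilon> * z (Inr v))"
    for \<epsilon> and z :: "(nat + nat) + ('i + 'j) \<Rightarrow> 'a"
  define \<Psi> where "\<Psi> k \<epsilon> z =
      (\<Sum>(i, j)\<in>N2. poly (R i j k) \<epsilon> * (z (Inl (Inl i)) * z (Inl (Inr j))))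
      + (\<Sum>(a, b, c)\<in>P. poly (C k c * [:entry T a b c:]) \<epsilon> * X a b \<epsilon> z)"
    for k \<epsilon> and z :: "(nat + nat) + ('i + 'j) \<Rightarrow> 'a"

  have var: "polyfun J 1 (\<lambda>z :: (nat + nat) + ('i + 'j) \<Rightarrow> 'a. z v)" if "v \<in> J" for v
    using polyfam_var[OF J that, of 0] by simp
  have La: "polyfam J 1 (\<lambda>\<epsilon> z. La \<epsilon> z a)" for a
    unfolding La_def by (intro polyfam_sum[OF J] polyfam_smult var) (auto simp: J_def)
  have Lb: "polyfam J 1 (\<lambda>\<epsilon> z. Lb \<epsilon> z b)" for b
    unfolding Lb_def by (intro polyfam_sum[OF J] polyfam_smult var) (auto simp: J_def)
  have L: "polyfam J 1 (\<lambda>\<epsilon> z. L \<epsilon> z v)" if "v \<in> I" for v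
  proof -
    have "polyfam J 1 (\<lambda>\<epsilon> z. (case v of Inl a \<Rightarrow> La \<epsilon> z a | Inr b \<Rightarrow> Lb \<epsilon> z b)
      + poly (monom 1 (t + 1)) \<epsilon> * z (Inr v))"
    proof (intro polyfam_add polyfam_smult var)
      show "polyfam J 1 (\<lambda>\<epsilon> z. case v of Inl a \<Rightarrow> La \<epsilon> z a | Inr b \<Rightarrow> Lb \<epsilon> z b)"
        using La Lb by (cases v) auto
    qed (use that in \<open>auto simp: J_def\<close>)
    then show ?thesis using that by (simp add: L_def)
  qed
  have mult: "polyfam J 2 (\<lambda>\<epsilon> z. F \<epsilon> z * G \<epsilon> z)" if "polyfam J 1 F" "polyfam J 1 G"
    for F G :: "'a \<Rightarrow> ((nat + nat) + ('i + 'j) \<Rightarrow> 'a) \<Rightarrow> 'a"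
    using polyfam_mult[OF J that] by (simp add: numeral_2_eq_2)
  have X: "polyfam J 2 (X a b)" if "a \<in> idx1 T" "b \<in> idx2 T" for a b
    unfolding X_def by (intro polyfam_add polyfam_smult mult La Lb var) (use that in \<open>auto simp: J_def I_def\<close>)
  have \<Psi>: "polyfam J 2 (\<Psi> k)" if "k < n" for k
    unfolding \<Psi>_def case_prod_beta
    by (intro polyfam_add polyfam_sum[OF J] polyfam_smult mult var X) (auto simp: J_def N2_def P_def)
  have surj: "\<exists>z. L \<epsilon> z = x \<and> (\<forall>l. z (Inl l) = s l)" if \<epsilon>: "\<epsilon> \<noteq> 0" and x: "x \<in> affine_space I" for \<epsilon> x s
  proof (intro exI conjI allI)
    \<comment> \<open>\<open>La\<close> and \<open>Lb\<close> read only the entries prescribed by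
      \<open>s\<close>, so their values are known before the remaining entries are solved
      for.\<close>
    define z0 :: "(nat + nat) + ('i + 'j) \<Rightarrow> 'a" where "z0 = case_sum s (\<lambda>_. 0)"
    define z where "z = case_sum s (\<lambda>v. (x v - (case v of Inl a \<Rightarrow> La \<epsilon> z0 a | Inr b \<Rightarrow> Lb \<epsilon> z0 b)) / \<epsilon> ^ (t + 1))"
    show "z (Inl l) = s l" for l by (simp add: z_def)
    have "La \<epsilon> z a = La \<epsilon> z0 a" "Lb \<epsilon> z b = Lb \<epsilon> z0 b" for a b
      by (simp_all add: La_def Lb_def z_def z0_def)
    then have "L \<epsilon> z v = x v" if "v \<in> I" for v
      using that \<epsilon> by (auto simp: L_def z_def poly_monom split: sum.split)
    then show "L \<epsilon> z = x"
      using x by (intro PiE_ext[where k = I]) (auto simp: affine_space_def L_def)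
  qed
  have rel: "z (Inl (Inl k)) * z (Inl (Inr k)) + \<epsilon> * \<Psi> k \<epsilon> z = 0"
    if k: "k < n" and \<epsilon>: "\<epsilon> \<noteq> 0" and ker: "L \<epsilon> z \<in> kernel_variety T" for k \<epsilon> z
  proof -
    define u where "u p = z (Inl (Inl p))" for p
    define v where "v p = z (Inl (Inr p))" for p
    define g where "g i j = (\<Sum>(a, b, c)\<in>P. poly (A i a) \<epsilon> * poly (B j b) \<epsilon> * poly (C k c) \<epsilon> * entry T a b c)" for i j
    have g: "g i j = \<epsilon> ^ t * ((if i = j \<and> j = k then 1 else 0) + \<epsilon> * poly (R i j k) \<epsilon>)" if "(i, j) \<in> N2" for i j
      using deg[OF \<epsilon> _ _ k, of i j] that by (simp add: g_def P_def N2_def sum.cartesian_product)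
    \<comment> \<open>The kernel equations are combined with the weights \<open>C k c\<close>, which
      produces slice \<open>k\<close> of the degenerating tensor.\<close>
    have "0 = (\<Sum>c\<in>idx3 T. poly (C k c) \<epsilon> *
        (\<Sum>a\<in>idx1 T. \<Sum>b\<in>idx2 T. entry T a b c * L \<epsilon> z (Inl a) * L \<epsilon> z (Inr b)))"
      using kernel_varietyD[OF ker _ fin(3)] by simp
    also have "\<dots> = (\<Sum>c\<in>idx3 T. \<Sum>a\<in>idx1 T. \<Sum>b\<in>idx2 T. poly (C k c) \<epsilon> * entry T a b c * (L \<epsilon> z (Inl a) * L \<epsilon> z (Inr b)))"
      by (simp add: sum_distrib_left mult.assoc)
    also have "\<dots> = (\<Sum>a\<in>idx1 T. \<Sum>b\<in>idx2 T. \<Sum>c\<in>idx3 T. poly (C k c) \<epsilon> * entry T a b c * (L \<epsilon> z (Inl a) * L \<epsilon> z (Inr b)))"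
      by (subst sum.swap, intro sum.cong refl, rule sum.swap)
    also have "\<dots> = (\<Sum>(a, b, c)\<in>P. poly (C k c) \<epsilon> * entry T a b c * (L \<epsilon> z (Inl a) * L \<epsilon> z (Inr b)))"
      by (simp add: P_def sum.cartesian_product)
    also have "\<dots> = (\<Sum>(a, b, c)\<in>P. poly (C k c) \<epsilon> * entry T a b c * (La \<epsilon> z a * Lb \<epsilon> z b)
        + \<epsilon> ^ (t + 1) * (poly (C k c * [:entry T a b c:]) \<epsilon> * X a b \<epsilon> z))"
      by (intro sum.cong refl)
        (auto simp: P_def L_def I_def X_def poly_monom algebra_simps)
    also have "\<dots> = (\<Sum>(a, b, c)\<in>P. poly (C k c) \<epsilon> * entry T a b c * (La \<epsilon> z a * Lb \<epsilon> z b))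
        + \<epsilon> ^ (t + 1) * (\<Sum>(a, b, c)\<in>P. poly (C k c * [:entry T a b c:]) \<epsilon> * X a b \<epsilon> z)"
      by (simp add: case_prod_beta sum.distrib sum_distrib_left del: poly_mult)
    also have "(\<Sum>(a, b, c)\<in>P. poly (C k c) \<epsilon> * entry T a b c * (La \<epsilon> z a * Lb \<epsilon> z b)) =
        (\<Sum>(a, b, c)\<in>P. \<Sum>(i, j)\<in>N2. u i * v j * (poly (A i a) \<epsilon> * poly (B j b) \<epsilon> * poly (C k c) \<epsilon> * entry T a b c))"
      unfolding La_def Lb_def sum_product N2_def sum.cartesian_product u_def[symmetric] v_def[symmetric]
      by (intro sum.cong refl) (auto simp: sum_distrib_left mult_ac intro!: sum.cong)
    also have "\<dots> = (\<Sum>(i, j)\<in>N2. u i * v j * g i j)"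
      unfolding g_def case_prod_beta by (subst sum.swap) (simp add: sum_distrib_left)
    also have "\<dots> = (\<Sum>(i, j)\<in>N2. \<epsilon> ^ t * ((if i = k \<and> j = k then u i * v j else 0) +
        \<epsilon> * (poly (R i j k) \<epsilon> * (u i * v j))))"
      by (intro sum.cong refl) (auto simp: g algebra_simps)
    also have "\<dots> = \<epsilon> ^ t * ((\<Sum>(i, j)\<in>N2. if i = k \<and> j = k then u i * v j else 0) +
        \<epsilon> * (\<Sum>(i, j)\<in>N2. poly (R i j k) \<epsilon> * (u i * v j)))"
      by (simp add: case_prod_beta sum.distrib sum_distrib_left distrib_left)
    also have "(\<Sum>(i, j)\<in>N2. if i = k \<and> j = k then u i * v j else 0) = (\<Sum>y\<in>N2. if y = (k, k) then u k * v k else 0)"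
      by (intro sum.cong refl) (auto split: if_splits)
    also have "\<dots> = u k * v k" using k by (simp add: N2_def)
    finally have "0 = \<epsilon> ^ t * (u k * v k + \<epsilon> * \<Psi> k \<epsilon> z)"
      unfolding \<Psi>_def u_def v_def by (simp add: algebra_simps)
    then show ?thesis using \<epsilon> by (simp add: u_def v_def)
  qed
  show ?thesis
    by (intro exI[of _ L] exI[of _ \<Psi>] conjI ballI allI impI)
      (rule L \<Psi> surj rel; assumption)+
qed

text \<open>A single inequality serves both maxima: a known chain bounds every unit tensor, and a
  known unit tensor bounds every chain.\<close>

theorem degeneration_chain_bound:
  fixes T :: "('i, 'j, 'k, 'a::field) tensor" and Z :: "nat \<Rightarrow> ('i + 'j \<Rightarrow> 'a) set"
  assumes inf: "infinite (UNIV :: 'a set)"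
    and deg: "(unit_tensor n :: (nat, nat, nat, 'a) tensor) \<unlhd> T"
    and fin: "finite (idx1 T)" "finite (idx2 T)" "finite (idx3 T)"
    and Z: "\<And>i. i \<le> d \<Longrightarrow> irreducible_closed (idx1 T <+> idx2 T) (Z i)"
      "\<And>i. i < d \<Longrightarrow> Z i \<subset> Z (Suc i)" "Z d \<subseteq> kernel_variety T"
  shows "d + n \<le> card (idx1 T <+> idx2 T)"
proof (rule ccontr)
  let ?I = "idx1 T <+> idx2 T"
  let ?U = "{..<n} <+> {..<n}"
  let ?J = "?U <+> ?I"
  let ?u = "\<lambda>k :: nat. Inl (Inl k) :: (nat + nat) + ('i + 'j)"
  let ?v = "\<lambda>k :: nat. Inl (Inr k) :: (nat + nat) + ('i + 'j)"
  define N where "N = card ?I"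
  assume "\<not> ?thesis"
  then have large: "N + n + 1 \<le> d + 2 * n" by (simp add: N_def)
  have I: "finite ?I" and J: "finite ?J" using fin by auto
  obtain q f where f: "\<forall>i<d. polyfun ?I q (f i)" "alg_indep f {..<d} (Z d)"
    using chain_alg_indep[where Z = Z and d = d, OF I Z(1,2)] by blast
  obtain L :: "'a \<Rightarrow> ((nat + nat) + ('i + 'j) \<Rightarrow> 'a) \<Rightarrow> 'i + 'j \<Rightarrow> 'a" and \<Psi> where
    L: "\<forall>v\<in>?I. polyfam ?J 1 (\<lambda>\<epsilon> z. L \<epsilon> z v)"
    and \<Psi>: "\<forall>k<n. polyfam ?J 2 (\<Psi> k)"
    and surj: "\<forall>\<epsilon> x s. \<epsilon> \<noteq> 0 \<longrightarrow> x \<in> affine_space ?I \<longrightarrow> (\<exists>z. L \<epsilon> z = x \<and> (\<forall>l. z (Inl l) = s l))"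
    and rel: "\<forall>\<epsilon> z. \<forall>k<n. \<epsilon> \<noteq> 0 \<longrightarrow> L \<epsilon> z \<in> kernel_variety T \<longrightarrow>
      z (?u k) * z (?v k) + \<epsilon> * \<Psi> k \<epsilon> z = 0"
    using degeneration_substitution[OF deg fin] by (elim exE conjE) blast
  define D where "D = {..<d} <+> ?U"
  have D: "finite D" "card D = d + 2 * n" by (simp_all add: D_def card_Plus)
  \<comment> \<open>\<open>c\<close> ensures \<open>Q + 1 \<le> c * (b + 1)\<close>, and
    \<open>b\<close> is taken equal to the constant factor of the monomial count. That count is then
    at most \<open>b * (b + 1) ^ (n + N)\<close>, which is less than
    \<open>(b + 1) ^ (N + n + 1)\<close>.\<close>
  define c where "c = card D * Suc q + 1"
  define b where "b = 2 ^ n * c ^ (n + N)"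
  define Q where "Q = card D * b * Suc q"
  let ?M = "monomials_avoiding_pairs ?J Q n ?u ?v"

  have "\<exists>E. finite E \<and> (\<forall>\<epsilon>. \<epsilon> \<notin> E \<longrightarrow> (\<exists>\<gamma>. \<forall>z.
           (\<forall>k<n. z (?u k) * z (?v k) + \<epsilon> * \<Psi> k \<epsilon> z = 0) \<longrightarrow>
           (\<forall>\<alpha>\<in>exponents ?J Q. mon ?J \<alpha> z = (\<Sum>\<beta>\<in>?M. \<gamma> \<alpha> \<beta> * mon ?J \<beta> z))))"
    using \<Psi> by (intro monomials_avoiding_pairs_span[OF J]) auto
  then obtain E where E: "finite E" "\<forall>\<epsilon>. \<epsilon> \<notin> E \<longrightarrow> (\<exists>\<gamma>. \<forall>z.
           (\<forall>k<n. z (?u k) * z (?v k) + \<epsilon> * \<Psi> k \<epsilon> z = 0) \<longrightarrow>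
           (\<forall>\<alpha>\<in>exponents ?J Q. mon ?J \<alpha> z = (\<Sum>\<beta>\<in>?M. \<gamma> \<alpha> \<beta> * mon ?J \<beta> z)))"
    by blast
  \<comment> \<open>\<epsilon> can be chosen only now, since the finite set \<open>E\<close> depends
    on the degree \<open>Q\<close>.\<close>
  obtain \<epsilon> where \<epsilon>: "\<epsilon> \<notin> insert 0 E"
    using ex_new_if_finite[OF inf, of "insert 0 E"] E(1) by blast
  then obtain \<gamma> where \<gamma>: "\<And>z \<alpha>. (\<forall>k<n. z (?u k) * z (?v k) + \<epsilon> * \<Psi> k \<epsilon> z = 0) \<Longrightarrow>
      \<alpha> \<in> exponents ?J Q \<Longrightarrow> mon ?J \<alpha> z = (\<Sum>\<beta>\<in>?M. \<gamma> \<alpha> \<beta> * mon ?J \<beta> z)"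
    using E(2) by blast
  define S where "S = {z. L \<epsilon> z \<in> Z d}"
  define F where "F k z = (case k of Inl i \<Rightarrow> f i (L \<epsilon> z) | Inr l \<Rightarrow> z (Inl l))"
    for k and z :: "(nat + nat) + ('i + 'j) \<Rightarrow> 'a"
  have indep: "alg_indep F D S"
  proof (rule alg_indep_transport)
    show "alg_indep (\<lambda>k (x, t). case k of Inl k \<Rightarrow> f k x | Inr l \<Rightarrow> t l) D (Z d \<times> UNIV)"
      unfolding D_def by (rule alg_indep_free_variables[OF inf _ _ f(2)]) auto
    fix y :: "('i + 'j \<Rightarrow> 'a) \<times> (nat + nat \<Rightarrow> 'a)" assume y: "y \<in> Z d \<times> UNIV"
    then have "fst y \<in> affine_space ?I" using Z(3) by (auto simp: kernel_variety_def)
    then obtain z where "L \<epsilon> z = fst y" "\<forall>l. z (Inl l) = snd y l" using surj \<epsilon> by blast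
    then show "\<exists>z\<in>S. \<forall>k\<in>D. F k z = (case y of (x, t) \<Rightarrow> case k of Inl k \<Rightarrow> f k x | Inr l \<Rightarrow> t l)"
      using y by (intro bexI[of _ z]) (auto simp: F_def S_def split: sum.split)
  qed
  have "(b + 1) ^ card D \<le> card ?M"
  proof (rule alg_indep_card_le[OF J D(1) indep])
    show "polyfun ?J (Suc q) (F k)" if "k \<in> D" for k
    proof (cases k)
      case (Inl i)
      then have i: "i < d" using that by (auto simp: D_def)
      have "polyfun ?J 1 (\<lambda>z. L \<epsilon> z v)" if "v \<in> ?I" for v
        using polyfam_at[OF bspec[OF L that], of \<epsilon>] by simp
      then have "polyfun ?J (q * 1) (\<lambda>z. f i (L \<epsilon> z))"
        using f(1) i by (intro polyfun_compose[OF I J]) auto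
      then have "polyfun ?J (Suc q) (\<lambda>z. f i (L \<epsilon> z))"
        by (rule polyfam_mono[OF J]) simp
      moreover have "F k = (\<lambda>z. f i (L \<epsilon> z))" using Inl by (simp add: F_def fun_eq_iff)
      ultimately show ?thesis by (simp only:)
    next
      case (Inr l)
      have "polyfun ?J (Suc q) (\<lambda>z. z (Inl l))"
        using that Inr by (intro polyfam_var[OF J]) (auto simp: D_def)
      moreover have "F k = (\<lambda>z. z (Inl l))" using Inr by (simp add: F_def fun_eq_iff)
      ultimately show ?thesis by (simp only:)
    qed
    show "finite ?M"
      by (rule finite_subset[OF _ finite_exponents[OF J]]) (auto simp: monomials_avoiding_pairs_def)
    show "mon ?J \<alpha> z = (\<Sum>\<beta>\<in>?M. \<gamma> \<alpha> \<beta> * mon ?J \<beta> z)"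
      if "\<alpha> \<in> exponents ?J (card D * b * Suc q)" "z \<in> S" for \<alpha> z
      using that Z(3) rel \<epsilon> by (intro \<gamma>) (auto simp: S_def Q_def)
  qed
  also have "card ?M \<le> 2 ^ n * (Q + 1) ^ (n + N)"
    unfolding N_def by (rule card_monomials_avoiding_pairs[OF I])
  also have "Q + 1 \<le> c * (b + 1)"
    by (simp add: Q_def c_def algebra_simps)
  also have "2 ^ n * (c * (b + 1)) ^ (n + N) = b * (b + 1) ^ (n + N)"
    by (simp only: power_mult_distrib) (simp only: b_def mult.assoc)
  also have "\<dots> < (b + 1) ^ (N + n + 1)"
    by (simp add: add.commute)
  also have "\<dots> \<le> (b + 1) ^ card D"
    using large D(2) by (intro power_increasing) auto
  finally show False by (simp add: power_mono)
qed

section \<open>Chains of parametrized irreducible sets\<close>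

text \<open>Phrased by vanishing functions, so that a polynomial equation valid on \<open>S\<close>
  passes to the closure at once.\<close>

definition zclosure :: "'v set \<Rightarrow> ('v \<Rightarrow> 'a::field) set \<Rightarrow> ('v \<Rightarrow> 'a) set" where
  "zclosure I S = {x \<in> affine_space I. \<forall>q f. polyfun I q f \<longrightarrow> (\<forall>y\<in>S. f y = 0) \<longrightarrow> f x = 0}"

lemma zariski_closed_zclosure:
  assumes "finite I"
  shows "zariski_closed I (zclosure I S)"
proof -
  define P where "P = {p \<in> poly_ring I. \<forall>y\<in>S. eval_poly p y = 0}"
  have "zclosure I S = {x \<in> affine_space I. \<forall>p\<in>P. eval_poly p x = 0}"
  proof (intro equalityI subsetI)
    fix x assume x: "x \<in> zclosure I S"
    have "eval_poly p x = 0" if "p \<in> P" for p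
    proof -
      obtain q where "polyfun I q (eval_poly p)"
        using eval_poly_polyfun[OF assms] \<open>p \<in> P\<close> unfolding P_def by blast
      then show ?thesis using x \<open>p \<in> P\<close> unfolding P_def zclosure_def by blast
    qed
    then show "x \<in> {x \<in> affine_space I. \<forall>p\<in>P. eval_poly p x = 0}"
      using x unfolding zclosure_def by blast
  next
    fix x assume x: "x \<in> {x \<in> affine_space I. \<forall>p\<in>P. eval_poly p x = 0}"
    have "f x = 0" if f: "polyfun I q f" "\<forall>y\<in>S. f y = 0" for q f
    proof -
      obtain p where "p \<in> poly_ring I" "\<forall>x. eval_poly p x = f x"
        using polyfun_eval_poly[OF assms f(1)] by blast
      then show ?thesis using x f(2) unfolding P_def by auto
    qed
    then show "x \<in> zclosure I S" using x unfolding zclosure_def by blast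
  qed
  moreover have "P \<subseteq> poly_ring I" by (auto simp: P_def)
  ultimately show ?thesis unfolding zariski_closed_def by (intro exI[of _ P]) simp
qed

lemma subset_zclosure: "S \<subseteq> affine_space I \<Longrightarrow> S \<subseteq> zclosure I S"
  unfolding zclosure_def by blast

lemma zclosure_mono: "S \<subseteq> S' \<Longrightarrow> zclosure I S \<subseteq> zclosure I S'"
  unfolding zclosure_def by blast

lemma zclosure_least:
  assumes "finite I" "zariski_closed I V" "S \<subseteq> V"
  shows "zclosure I S \<subseteq> V"
proof
  fix x assume x: "x \<in> zclosure I S"
  show "x \<in> V"
  proof (rule ccontr)
    assume "x \<notin> V"
    moreover have "x \<in> affine_space I" using x unfolding zclosure_def by blast
    ultimately obtain q f where "polyfun I q f" "\<forall>y\<in>V. f y = 0" "f x \<noteq> 0"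
      using zariski_closed_separate[OF assms(1,2)] by blast
    then show False using x assms(3) unfolding zclosure_def by blast
  qed
qed

text \<open>
  Two polynomials not vanishing on the image have pullbacks not vanishing identically on the
  line through two suitable points of \<open>L\<close>, so neither does their product.
\<close>

lemma irreducible_closed_zclosure_image:
  fixes \<phi> :: "('v \<Rightarrow> 'a::field) \<Rightarrow> ('v \<Rightarrow> 'a)"
  assumes inf: "infinite (UNIV :: 'a set)" and I: "finite I"
    and \<phi>: "\<And>v. v \<in> I \<Longrightarrow> polyfun I p (\<lambda>t. \<phi> t v)" "\<And>t. \<phi> t \<in> affine_space I"
    and L: "L \<noteq> {}" "\<And>a b s. a \<in> L \<Longrightarrow> b \<in> L \<Longrightarrow> (\<lambda>v. a v + s * (b v - a v)) \<in> L"
  shows "irreducible_closed I (zclosure I (\<phi> ` L))"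
  unfolding irreducible_closed_def
proof (intro conjI allI impI)
  have sub: "\<phi> ` L \<subseteq> zclosure I (\<phi> ` L)" using \<phi>(2) by (intro subset_zclosure) auto
  then show "zclosure I (\<phi> ` L) \<noteq> {}" using L(1) by blast
  show "zariski_closed I (zclosure I (\<phi> ` L))" by (rule zariski_closed_zclosure[OF I])
  fix V1 V2
  assume V: "zariski_closed I V1" "zariski_closed I V2" "zclosure I (\<phi> ` L) = V1 \<union> V2"
  show "zclosure I (\<phi> ` L) = V1 \<or> zclosure I (\<phi> ` L) = V2"
  proof (rule ccontr)
    assume neq: "\<not> ?thesis"
    have "\<not> \<phi> ` L \<subseteq> V1" "\<not> \<phi> ` L \<subseteq> V2"
      using zclosure_least[OF I V(1), of "\<phi> ` L"] zclosure_least[OF I V(2), of "\<phi> ` L"] neq V(3) by auto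
    then obtain a b where ab: "a \<in> L" "\<phi> a \<notin> V1" "b \<in> L" "\<phi> b \<notin> V2" by blast
    obtain q f where f: "polyfun I q f" "\<forall>y\<in>V1. f y = 0" "f (\<phi> a) \<noteq> 0"
      using zariski_closed_separate[OF I V(1) \<phi>(2) ab(2)] by blast
    obtain q' g where g: "polyfun I q' g" "\<forall>y\<in>V2. g y = 0" "g (\<phi> b) \<noteq> 0"
      using zariski_closed_separate[OF I V(2) \<phi>(2) ab(4)] by blast
    have f\<phi>: "polyfun I (q * p) (\<lambda>t. f (\<phi> t))"
      by (rule polyfun_compose[OF I I f(1) \<phi>(1)])
    have g\<phi>: "polyfun I (q' * p) (\<lambda>t. g (\<phi> t))"
      by (rule polyfun_compose[OF I I g(1) \<phi>(1)])
    obtain P where P: "\<forall>s. f (\<phi> (\<lambda>v. a v + s * (b v - a v))) = poly P s"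
      using polyfun_line[OF f\<phi>, of a "\<lambda>v. b v - a v"] by (elim exE)
    obtain Q where Q: "\<forall>s. g (\<phi> (\<lambda>v. a v + s * (b v - a v))) = poly Q s"
      using polyfun_line[OF g\<phi>, of a "\<lambda>v. b v - a v"] by (elim exE)
    have "poly P 0 \<noteq> 0" using f(3) P[rule_format, of 0] by simp
    moreover have "poly Q 1 \<noteq> 0" using g(3) Q[rule_format, of 1] by simp
    moreover have "poly (P * Q) s = 0" for s
    proof -
      have "\<phi> (\<lambda>v. a v + s * (b v - a v)) \<in> V1 \<union> V2"
        using sub L(2)[OF ab(1,3), of s] V(3) by auto
      then show ?thesis using f(2) g(2) P[rule_format, of s] Q[rule_format, of s] by auto
    qed
    then have "P * Q = 0" by (rule poly_eq_0_if_vanishing[OF inf])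
    ultimately show False by auto
  qed
qed

text \<open>The images of the coordinate subspaces \<open>L i\<close> have irreducible closures. The
  inclusions are strict because the function reading off coordinate \<open>xs ! i\<close> vanishes
  on the image of \<open>L i\<close> but not on that of \<open>L (Suc i)\<close>. It has to read
  correctly only on \<open>L (Suc i)\<close>, so the order of \<open>xs\<close> matters.\<close>

lemma parametrized_chain:
  fixes \<phi> :: "('v \<Rightarrow> 'a::field) \<Rightarrow> ('v \<Rightarrow> 'a)" and xs :: "'v list"
  defines "L \<equiv> \<lambda>i. {t. \<forall>v. v \<notin> set (take i xs) \<longrightarrow> t v = 0}"
  assumes inf: "infinite (UNIV :: 'a set)" and I: "finite I" and xs: "distinct xs"
    and \<phi>: "\<And>v. v \<in> I \<Longrightarrow> polyfun I p (\<lambda>t. \<phi> t v)" "\<And>t. \<phi> t \<in> affine_space I"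
    and read: "\<And>i. i < length xs \<Longrightarrow> \<exists>q g. polyfun I q g \<and> (\<forall>t\<in>L (Suc i). g (\<phi> t) = t (xs ! i))"
  shows "\<exists>Z. (\<forall>i\<le>length xs. irreducible_closed I (Z i) \<and> Z i \<subseteq> zclosure I (range \<phi>)) \<and>
    (\<forall>i<length xs. Z i \<subset> Z (Suc i))"
proof (intro exI conjI allI impI)
  let ?Z = "\<lambda>i. zclosure I (\<phi> ` L i)"
  show "irreducible_closed I (?Z i)" for i
  proof (rule irreducible_closed_zclosure_image[OF inf I \<phi>])
    have "(\<lambda>_. 0) \<in> L i" by (simp add: L_def)
    then show "L i \<noteq> {}" by blast
  qed (auto simp: L_def)
  show "?Z i \<subseteq> zclosure I (range \<phi>)" for i by (rule zclosure_mono) auto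
  fix i assume i: "i < length xs"
  have "L i \<subseteq> L (Suc i)" using i by (auto simp: L_def take_Suc_conv_app_nth)
  then have "?Z i \<subseteq> ?Z (Suc i)" by (intro zclosure_mono image_mono)
  moreover have "?Z i \<noteq> ?Z (Suc i)"
  proof
    assume eq: "?Z i = ?Z (Suc i)"
    obtain q g where g: "polyfun I q g" "\<forall>t\<in>L (Suc i). g (\<phi> t) = t (xs ! i)"
      using read[OF i] by blast
    define t where "t = (\<lambda>v. if v = xs ! i then 1 else 0 :: 'a)"
    have t: "t \<in> L (Suc i)" using i by (auto simp: L_def t_def take_Suc_conv_app_nth)
    have "\<phi> t \<in> ?Z (Suc i)" using subset_zclosure[of "\<phi> ` L (Suc i)" I] \<phi>(2) t by auto
    then have "\<phi> t \<in> ?Z i" using eq by simp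
    moreover have "\<forall>y\<in>\<phi> ` L i. g y = 0"
    proof
      fix y assume "y \<in> \<phi> ` L i"
      then obtain s where s: "s \<in> L i" "y = \<phi> s" by blast
      have "xs ! i \<notin> set (take i xs)"
        using xs i by (auto simp: in_set_conv_nth distinct_conv_nth)
      then have "s (xs ! i) = 0" using s(1) by (simp add: L_def)
      then show "g y = 0" using s g(2) \<open>L i \<subseteq> L (Suc i)\<close> by auto
    qed
    ultimately have "g (\<phi> t) = 0" using g(1) unfolding zclosure_def by blast
    then show False using g(2) t by (auto simp: t_def)
  qed
  ultimately show "?Z i \<subset> ?Z (Suc i)" by blast
qed

section \<open>The matrix multiplication tensor\<close>

text \<open>Testing against the basis vector \<open>(k, i)\<close> picks out the entry of X Y in row
  \<open>i\<close> and column \<open>k\<close>.\<close>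

lemma kernel_variety_matmul_tensor:
  "kernel_variety (matmul_tensor e h l :: 'a::field matmul_tensor) =
     {x \<in> affine_space (({..<e} \<times> {..<h}) <+> ({..<h} \<times> {..<l})).
        \<forall>k<l. \<forall>i<e. (\<Sum>j<h. x (Inl (i, j)) * x (Inr (j, k))) = 0}"
proof -
  have "trilinear_form (matmul_tensor e h l) (x \<circ> Inl) (x \<circ> Inr) (std_basis (k, i)) =
      (\<Sum>j<h. x (Inl (i, j)) * x (Inr (j, k)))" if "k < l" "i < e"
    for x :: "(nat \<times> nat) + (nat \<times> nat) \<Rightarrow> 'a" and k i
  proof -
    have "x (Inl (i', j)) * x (Inr (j, k')) * std_basis (k, i) (k', i') =
        (if k' = k then if i' = i then x (Inl (i, j)) * x (Inr (j, k)) else 0 else 0)" for i' j k'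
      by (auto simp: std_basis_def)
    then have "trilinear_form (matmul_tensor e h l) (x \<circ> Inl) (x \<circ> Inr) (std_basis (k, i)) =
        (\<Sum>i'<e. \<Sum>j<h. if i' = i then x (Inl (i, j)) * x (Inr (j, k)) else 0)"
      using that by (simp add: trilinear_form_matmul_tensor)
    also have "\<dots> = (\<Sum>j<h. \<Sum>i'<e. if i' = i then x (Inl (i, j)) * x (Inr (j, k)) else 0)"
      by (rule sum.swap)
    finally show ?thesis using that by simp
  qed
  then show ?thesis
    unfolding kernel_variety_def by (auto simp: matmul_tensor_def)
qed

lemma zclosure_subset_kernel_variety_matmul:
  fixes e h l :: nat
  defines "I \<equiv> ({..<e} \<times> {..<h}) <+> ({..<h} \<times> {..<l})"
  assumes "S \<subseteq> kernel_variety (matmul_tensor e h l :: 'a::field matmul_tensor)"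
  shows "zclosure I S \<subseteq> kernel_variety (matmul_tensor e h l :: 'a matmul_tensor)"
proof
  fix x assume x: "x \<in> zclosure I S"
  have I: "finite I" by (simp add: I_def)
  have "(\<Sum>j<h. x (Inl (i, j)) * x (Inr (j, k))) = 0" if "k < l" "i < e" for k i
  proof -
    have "polyfun I (1 + 1) (\<lambda>x :: (nat \<times> nat) + (nat \<times> nat) \<Rightarrow> 'a. \<Sum>j<h. x (Inl (i, j)) * x (Inr (j, k)))"
      using that polyfam_var[OF I, of _ 0]
      by (intro polyfam_sum[OF I] polyfam_mult[OF I]) (auto simp: I_def)
    moreover have "\<forall>y\<in>S. (\<Sum>j<h. y (Inl (i, j)) * y (Inr (j, k))) = 0"
      using assms(2) that by (auto simp: kernel_variety_matmul_tensor)
    ultimately show ?thesis using x unfolding zclosure_def by blast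
  qed
  then show "x \<in> kernel_variety (matmul_tensor e h l)"
    using x by (simp add: kernel_variety_matmul_tensor zclosure_def I_def)
qed

text \<open>
  The pairs \<open>(X, Y)\<close> with \<open>X Y = 0\<close> and \<open>X\<close> of rank \<open>r\<close> with invertible leading block \<open>P\<close> are
  \<open>X = (1; R) P (1, Q)\<close> and \<open>Y = (- Q Y'; Y')\<close>. The coordinates \<open>R, Q, Y'\<close> can be read off
  along \<open>P = 1\<close>, so they precede those of \<open>P\<close> in the chain.
\<close>

lemma matmul_kernel_chain:
  fixes e h l r :: nat
  assumes inf: "infinite (UNIV :: 'a::field set)" and r: "r \<le> e" "r \<le> h"
  shows "\<exists>Z :: nat \<Rightarrow> ((nat \<times> nat) + (nat \<times> nat) \<Rightarrow> 'a) set.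
    (\<forall>i\<le>r * (e + (h - r)) + (h - r) * l.
       irreducible_closed (({..<e} \<times> {..<h}) <+> ({..<h} \<times> {..<l})) (Z i) \<and>
       Z i \<subseteq> kernel_variety (matmul_tensor e h l :: 'a matmul_tensor)) \<and>
    (\<forall>i<r * (e + (h - r)) + (h - r) * l. Z i \<subset> Z (Suc i))"
proof -
  define I where "I = ({..<e} \<times> {..<h}) <+> ({..<h} \<times> {..<l})"
  have I: "finite I" by (simp add: I_def)
  \<comment> \<open>The positions of the blocks Q, R and Y', in this order; \<open>M2\<close> holds
    those of P.\<close>
  define M1 where "M1 = (({..<r} \<times> {r..<h}) \<union> ({r..<e} \<times> {..<r})) <+> ({r..<h} \<times> {..<l})"
  define M2 :: "((nat \<times> nat) + (nat \<times> nat)) set" where "M2 = Inl ` ({..<r} \<times> {..<r})"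
  have M: "M1 \<union> M2 \<subseteq> I" "M1 \<inter> M2 = {}" "finite M1" "finite M2"
    using r by (auto simp: M1_def M2_def I_def)
  obtain xs1 where xs1: "set xs1 = M1" "distinct xs1" using finite_distinct_list[OF M(3)] by blast
  obtain xs2 where xs2: "set xs2 = M2" "distinct xs2" using finite_distinct_list[OF M(4)] by blast
  define xs where "xs = xs1 @ xs2"
  have xs: "distinct xs" using xs1 xs2 M(2) by (auto simp: xs_def)
  have "card (({..<r} \<times> {r..<h}) \<union> ({r..<e} \<times> {..<r})) = r * (h - r) + (e - r) * r"
    by (subst card_Un_disjoint) (auto simp: card_cartesian_product)
  then have "card M1 = r * (h - r) + (e - r) * r + (h - r) * l"
    unfolding M1_def by (subst card_Plus) (auto simp: card_cartesian_product)
  moreover have "card M2 = r * r"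
    unfolding M2_def by (subst card_image) (auto simp: card_cartesian_product)
  moreover have "(e - r) * r + r * r = r * e"
    using r by (simp add: algebra_simps diff_mult_distrib2)
  ultimately have len: "length xs = r * (e + (h - r)) + (h - r) * l"
    using distinct_card[OF xs1(2)] distinct_card[OF xs2(2)] xs1 xs2
    by (simp add: xs_def algebra_simps)

  define lm where "lm t i a = (if i < r then if i = a then 1 else 0 else t (Inl (i, a)))"
    for t :: "(nat \<times> nat) + (nat \<times> nat) \<Rightarrow> 'a" and i a :: nat
  \<comment> \<open>P is shifted by the identity: coordinates not yet released in the chain then
    mean P = 1, whereas P = 0 would make X vanish and hide R and Q.\<close>
  define pm where "pm t a b = t (Inl (a, b)) + (if a = b then 1 else 0)"
    for t :: "(nat \<times> nat) + (nat \<times> nat) \<Rightarrow> 'a" and a b :: nat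
  define rm where "rm t b j = (if j < r then if j = b then 1 else 0 else t (Inl (b, j)))"
    for t :: "(nat \<times> nat) + (nat \<times> nat) \<Rightarrow> 'a" and b j :: nat
  define \<phi> where "\<phi> t = (\<lambda>v\<in>I. case v of
      Inl (i, j) \<Rightarrow> \<Sum>a<r. \<Sum>b<r. lm t i a * (pm t a b * rm t b j)
    | Inr (j, k) \<Rightarrow> if j < r then - (\<Sum>b\<in>{r..<h}. t (Inl (j, b)) * t (Inr (b, k))) else t (Inr (j, k)))"
    for t :: "(nat \<times> nat) + (nat \<times> nat) \<Rightarrow> 'a"
  have \<phi>_affine: "\<phi> t \<in> affine_space I" for t by (simp add: \<phi>_def affine_space_def)

  have var: "polyfun I 1 (\<lambda>t :: (nat \<times> nat) + (nat \<times> nat) \<Rightarrow> 'a. t v)" if "v \<in> I" for v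
    using polyfam_var[OF I that, of 0] by simp
  have lm: "polyfun I 1 (\<lambda>t. lm t i a)" if "i < e" "a < r" for i a
  proof -
    have "Inl (i, a) \<in> I" using that r by (auto simp: I_def)
    then show ?thesis using var by (cases "i < r") (simp_all add: lm_def polyfam_const[OF I] del: One_nat_def)
  qed
  have rm: "polyfun I 1 (\<lambda>t. rm t b j)" if "b < r" "j < h" for b j
  proof -
    have "Inl (b, j) \<in> I" using that r by (auto simp: I_def)
    then show ?thesis using var by (cases "j < r") (simp_all add: rm_def polyfam_const[OF I] del: One_nat_def)
  qed
  have pm: "polyfun I 1 (\<lambda>t. pm t a b)" if "a < r" "b < r" for a b
    unfolding pm_def using that r by (intro polyfam_add var polyfam_const[OF I]) (auto simp: I_def)
  have \<phi>: "polyfun I 3 (\<lambda>t. \<phi> t v)" if v: "v \<in> I" for v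
  proof (cases v)
    case (Inl y)
    then obtain i j where y: "v = Inl (i, j)" "i < e" "j < h" using v by (auto simp: I_def)
    have "polyfun I (1 + (1 + 1)) (\<lambda>t. \<Sum>a<r. \<Sum>b<r. lm t i a * (pm t a b * rm t b j))"
      using y by (intro polyfam_sum[OF I] polyfam_mult[OF I] lm pm rm) auto
    then show ?thesis using v by (simp add: \<phi>_def y numeral_3_eq_3)
  next
    case (Inr y)
    then obtain j k where y: "v = Inr (j, k)" "j < h" "k < l" using v by (auto simp: I_def)
    show ?thesis
    proof (cases "j < r")
      case True
      have "polyfun I (1 + 1) (\<lambda>t :: (nat \<times> nat) + (nat \<times> nat) \<Rightarrow> 'a. \<Sum>b\<in>{r..<h}. t (Inl (j, b)) * t (Inr (b, k)))"
        using y r True by (intro polyfam_sum[OF I] polyfam_mult[OF I] var) (auto simp: I_def)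
      from polyfam_mono[OF I polyfam_scale[OF this, of "-1"], of 3] show ?thesis
        using v True by (simp add: \<phi>_def y)
    next
      case False
      from polyfam_mono[OF I var[OF v], of 3] show ?thesis using v False by (simp add: \<phi>_def y)
    qed
  qed
  have ker: "\<phi> t \<in> kernel_variety (matmul_tensor e h l)" for t
  proof -
    have "(\<Sum>j<h. \<phi> t (Inl (i, j)) * \<phi> t (Inr (j, k))) = 0" if ik: "i < e" "k < l" for i k
    proof -
      \<comment> \<open>The rows of (1, Q) annihilate Y = (- Q Y'; Y').\<close>
      have zero: "(\<Sum>j<h. rm t b j * \<phi> t (Inr (j, k))) = 0" if b: "b < r" for b
      proof -
        have "{..<h} = {..<r} \<union> {r..<h}" using r by auto
        then have "(\<Sum>j<h. rm t b j * \<phi> t (Inr (j, k))) =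
            (\<Sum>j<r. rm t b j * \<phi> t (Inr (j, k))) + (\<Sum>j\<in>{r..<h}. rm t b j * \<phi> t (Inr (j, k)))"
          by (simp add: sum.union_disjoint ivl_disj_int)
        also have "(\<Sum>j<r. rm t b j * \<phi> t (Inr (j, k))) = (\<Sum>j<r. if j = b then \<phi> t (Inr (j, k)) else 0)"
          by (intro sum.cong refl) (auto simp: rm_def)
        also have "\<dots> = - (\<Sum>j\<in>{r..<h}. t (Inl (b, j)) * t (Inr (j, k)))"
          using b r ik by (simp add: \<phi>_def I_def)
        also have "(\<Sum>j\<in>{r..<h}. rm t b j * \<phi> t (Inr (j, k))) = (\<Sum>j\<in>{r..<h}. t (Inl (b, j)) * t (Inr (j, k)))"
          using ik by (intro sum.cong refl) (auto simp: rm_def \<phi>_def I_def)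
        finally show ?thesis by simp
      qed
      have "(\<Sum>j<h. \<phi> t (Inl (i, j)) * \<phi> t (Inr (j, k))) =
          (\<Sum>j<h. \<Sum>a<r. \<Sum>b<r. lm t i a * pm t a b * (rm t b j * \<phi> t (Inr (j, k))))"
      proof (intro sum.cong refl)
        fix j assume "j \<in> {..<h}"
        then have "\<phi> t (Inl (i, j)) = (\<Sum>a<r. \<Sum>b<r. lm t i a * (pm t a b * rm t b j))"
          using ik by (simp add: \<phi>_def I_def)
        then show "\<phi> t (Inl (i, j)) * \<phi> t (Inr (j, k)) =
            (\<Sum>a<r. \<Sum>b<r. lm t i a * pm t a b * (rm t b j * \<phi> t (Inr (j, k))))"
          by (simp add: sum_distrib_right mult.assoc)
      qed
      also have "\<dots> = (\<Sum>a<r. \<Sum>b<r. \<Sum>j<h. lm t i a * pm t a b * (rm t b j * \<phi> t (Inr (j, k))))"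
        by (subst sum.swap, rule sum.cong[OF refl], rule sum.swap)
      also have "\<dots> = 0" by (simp add: zero flip: sum_distrib_left)
      finally show ?thesis .
    qed
    then show ?thesis using \<phi>_affine[of t] by (simp add: kernel_variety_matmul_tensor I_def)
  qed
  have read: "\<exists>q g. polyfun I q g \<and> (\<forall>t\<in>{t. \<forall>v. v \<notin> set (take (Suc i) xs) \<longrightarrow> t v = 0}. g (\<phi> t) = t (xs ! i))"
    if i: "i < length xs" for i
  proof (cases "i < length xs1")
    case True
    have xi: "xs ! i \<in> M1" using True xs1 by (auto simp: xs_def nth_append)
    have "\<phi> t (xs ! i) = t (xs ! i)" if t: "\<forall>v. v \<notin> set (take (Suc i) xs) \<longrightarrow> t v = 0" for t
    proof -
      have "set (take (Suc i) xs) \<subseteq> M1"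
        using True set_take_subset[of "Suc i" xs1] xs1 by (simp add: xs_def)
      then have pm1: "pm t a b = (if a = b then 1 else 0)" if "a < r" "b < r" for a b
        using t that by (auto simp: pm_def M1_def)
      \<comment> \<open>With P = 1 the product is (1; R) (1, Q), whose blocks beside and below the
        leading square are Q and R.\<close>
      have X: "(\<Sum>a<r. \<Sum>b<r. lm t i a * (pm t a b * rm t b j)) = (\<Sum>a<r. lm t i a * rm t a j)" for i j
      proof (intro sum.cong refl)
        fix a assume a: "a \<in> {..<r}"
        have "(\<Sum>b<r. lm t i a * (pm t a b * rm t b j)) = (\<Sum>b<r. if b = a then lm t i a * rm t a j else 0)"
          using a by (intro sum.cong refl) (auto simp: pm1)
        then show "(\<Sum>b<r. lm t i a * (pm t a b * rm t b j)) = lm t i a * rm t a j" using a by simp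
      qed
      have "xs ! i \<in> I" using xi M(1) by blast
      moreover have "(\<Sum>a<r. lm t i a * rm t a j) = t (Inl (i, j))" if "i < r" "j \<ge> r" for i j
      proof -
        have "(\<Sum>a<r. lm t i a * rm t a j) = (\<Sum>a<r. if a = i then t (Inl (i, j)) else 0)"
          using that by (intro sum.cong refl) (auto simp: lm_def rm_def)
        then show ?thesis using that by simp
      qed
      moreover have "(\<Sum>a<r. lm t i a * rm t a j) = t (Inl (i, j))" if "i \<ge> r" "j < r" for i j
      proof -
        have "(\<Sum>a<r. lm t i a * rm t a j) = (\<Sum>a<r. if a = j then t (Inl (i, j)) else 0)"
          using that by (intro sum.cong refl) (auto simp: lm_def rm_def)
        then show ?thesis using that by simp
      qed
      ultimately show ?thesis using xi by (auto simp: \<phi>_def X M1_def)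
    qed
    moreover have "polyfun I 1 (\<lambda>x :: (nat \<times> nat) + (nat \<times> nat) \<Rightarrow> 'a. x (xs ! i))"
      using xi M(1) by (intro var) auto
    ultimately show ?thesis by blast
  next
    case False
    then have "xs ! i \<in> M2" using i xs2 by (auto simp: xs_def nth_append)
    then obtain a b where ab: "xs ! i = Inl (a, b)" "a < r" "b < r" by (auto simp: M2_def)
    have abI: "Inl (a, b) \<in> I" using ab r by (auto simp: I_def)
    \<comment> \<open>The leading square block of X is P, whatever the other coordinates
      are.\<close>
    have "\<phi> t (Inl (a, b)) + - (if a = b then 1 else 0) = t (Inl (a, b))" for t
    proof -
      have "(\<Sum>b'<r. lm t a a' * (pm t a' b' * rm t b' b)) = (if a' = a then pm t a b else 0)" for a'
      proof -
        have "(\<Sum>b'<r. lm t a a' * (pm t a' b' * rm t b' b)) =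
            (\<Sum>b'<r. if b' = b then lm t a a' * pm t a' b else 0)"
          using ab by (intro sum.cong refl) (auto simp: rm_def)
        then show ?thesis using ab by (simp add: lm_def)
      qed
      then have "(\<Sum>a'<r. \<Sum>b'<r. lm t a a' * (pm t a' b' * rm t b' b)) = pm t a b"
        using ab by simp
      then show ?thesis using ab abI by (simp add: \<phi>_def pm_def)
    qed
    moreover have "polyfun I 1 (\<lambda>x :: (nat \<times> nat) + (nat \<times> nat) \<Rightarrow> 'a. x (Inl (a, b)) + - (if a = b then 1 else 0))"
      by (intro polyfam_add var abI polyfam_const[OF I])
    ultimately show ?thesis unfolding ab(1) by blast
  qed
  have "zclosure I (range \<phi>) \<subseteq> kernel_variety (matmul_tensor e h l :: 'a matmul_tensor)"
    unfolding I_def by (rule zclosure_subset_kernel_variety_matmul) (use ker in auto)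
  then show ?thesis
    using parametrized_chain[OF inf I xs \<phi> \<phi>_affine read] unfolding len I_def[symmetric] by blast
qed

subsection \<open>Strassen's degeneration\<close>

text \<open>
  Weighting \<open>x(i, j)\<close>, \<open>y(j, k)\<close>, \<open>z(k, i)\<close> with the exponents below gives the term of
  \<open>(i, j, k)\<close> the exponent \<open>(i + j + k - c)^2\<close>. The terms with \<open>i + j + k = c\<close> survive at
  \<open>\<epsilon> = 0\<close>, and any two of \<open>i, j, k\<close> determine the third.
\<close>

lemma unit_tensor_degeneration_matmul:
  fixes a e h l :: nat
  defines "P \<equiv> {(i, j). i < e \<and> j < h \<and> a \<le> i + j \<and> i + j < a + l}"
  assumes l: "1 \<le> l"
  shows "(unit_tensor (card P) :: (nat, nat, nat, 'a::field) tensor) \<unlhd> matmul_tensor e h l"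
proof -
  have "finite P" by (rule finite_subset[of _ "{..<e} \<times> {..<h}"]) (auto simp: P_def)
  then obtain g where g: "bij_betw g {..<card P} P"
    using ex_bij_betw_nat_finite by (metis atLeast0LessThan)
  \<comment> \<open>The last diagonal of the band: c - (i + j) lies between 0 and l - 1 exactly for
    the cells of the band.\<close>
  define c where "c = a + l - 1"
  define \<alpha> where "\<alpha> p = fst (g p)" for p
  define \<beta> where "\<beta> p = snd (g p)" for p
  define \<kappa> where "\<kappa> p = c - (\<alpha> p + \<beta> p)" for p
  have gP: "\<alpha> p < e" "\<beta> p < h" "\<kappa> p < l" "\<alpha> p + \<beta> p + \<kappa> p = c" if "p < card P" for p
  proof -
    have "g p \<in> P" using g that by (auto simp: bij_betw_def)
    then show "\<alpha> p < e" "\<beta> p < h" "\<kappa> p < l" "\<alpha> p + \<beta> p + \<kappa> p = c"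
      using l by (auto simp: P_def \<alpha>_def \<beta>_def \<kappa>_def c_def)
  qed
  have inj: "p = p'" if "\<alpha> p = \<alpha> p'" "\<beta> p = \<beta> p'" "p < card P" "p' < card P" for p p'
    using that g by (auto simp: bij_betw_def inj_on_def \<alpha>_def \<beta>_def prod_eq_iff)
  \<comment> \<open>The square of i + j + k - c is split into i^2 + 2 i j - 2 c i and its cyclic
    shifts, with c^2 added to the last, since each matrix sees only two of the three
    indices.\<close>
  define A :: "nat \<Rightarrow> nat \<times> nat \<Rightarrow> 'a laurent_poly" where
    "A p x = (if x = (\<alpha> p, \<beta> p)
      then Poly_Mapping.single (int (\<alpha> p)^2 + 2 * int (\<alpha> p) * int (\<beta> p) - 2 * int c * int (\<alpha> p)) 1 else 0)" for p x
  define B :: "nat \<Rightarrow> nat \<times> nat \<Rightarrow> 'a laurent_poly" where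
    "B p x = (if x = (\<beta> p, \<kappa> p)
      then Poly_Mapping.single (int (\<beta> p)^2 + 2 * int (\<beta> p) * int (\<kappa> p) - 2 * int c * int (\<beta> p)) 1 else 0)" for p x
  define C :: "nat \<Rightarrow> nat \<times> nat \<Rightarrow> 'a laurent_poly" where
    "C p x = (if x = (\<kappa> p, \<alpha> p)
      then Poly_Mapping.single (int (\<kappa> p)^2 + 2 * int (\<kappa> p) * int (\<alpha> p) - 2 * int c * int (\<kappa> p) + int c ^ 2) 1 else 0)" for p x
  define M where "M p p' p'' \<longleftrightarrow> \<beta> p = \<beta> p' \<and> \<kappa> p' = \<kappa> p'' \<and> \<alpha> p = \<alpha> p''" for p p' p''
  define D where "D p p' = nat ((int (\<alpha> p) + int (\<beta> p) + int (\<kappa> p') - int c)^2)" for p p'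
  define e' where "e' = (\<Sum>p<card P. \<Sum>p'<card P. D p p')"
  define R :: "nat \<Rightarrow> nat \<Rightarrow> nat \<Rightarrow> nat \<Rightarrow> 'a" where
    "R q p p' p'' = (if M p p' p'' \<and> q = D p p' then 1 else 0)" for q p p' p''
  have act: "tensor_act A B C (to_laurent (matmul_tensor e h l)) p p' p'' =
      (if M p p' p'' then Poly_Mapping.single (int (D p p')) 1 else 0)"
    if p: "p < card P" "p' < card P" "p'' < card P" for p p' p''
  proof -
    let ?T = "to_laurent (matmul_tensor e h l) :: (nat \<times> nat, nat \<times> nat, nat \<times> nat, 'a laurent_poly) tensor"
    have idx: "idx1 ?T = {..<e} \<times> {..<h}" "idx2 ?T = {..<h} \<times> {..<l}" "idx3 ?T = {..<l} \<times> {..<e}"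
      by (simp_all add: to_laurent_def matmul_tensor_def)
    have "tensor_act A B C ?T p p' p'' =
        (\<Sum>x\<in>idx1 ?T. if x = (\<alpha> p, \<beta> p) then
          \<Sum>y\<in>idx2 ?T. if y = (\<beta> p', \<kappa> p') then
            \<Sum>z\<in>idx3 ?T. if z = (\<kappa> p'', \<alpha> p'') then
              A p (\<alpha> p, \<beta> p) * B p' (\<beta> p', \<kappa> p') * C p'' (\<kappa> p'', \<alpha> p'') *
                entry ?T (\<alpha> p, \<beta> p) (\<beta> p', \<kappa> p') (\<kappa> p'', \<alpha> p'')
            else 0 else 0 else 0)"
      unfolding tensor_act_def
      by (intro sum.cong refl) (auto simp: A_def B_def C_def intro!: sum.cong)
    also have "\<dots> = A p (\<alpha> p, \<beta> p) * B p' (\<beta> p', \<kappa> p') * C p'' (\<kappa> p'', \<alpha> p'') *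
        entry ?T (\<alpha> p, \<beta> p) (\<beta> p', \<kappa> p') (\<kappa> p'', \<alpha> p'')"
      using gP p by (simp add: idx)
    also have "\<dots> = (if M p p' p'' then Poly_Mapping.single (int (D p p')) 1 else 0)"
    proof (cases "M p p' p''")
      case True
      then have m: "\<beta> p' = \<beta> p" "\<kappa> p'' = \<kappa> p'" "\<alpha> p'' = \<alpha> p" by (auto simp: M_def)
      have ent: "entry ?T (\<alpha> p, \<beta> p) (\<beta> p, \<kappa> p') (\<kappa> p', \<alpha> p) = 1"
        by (simp add: to_laurent_def matmul_tensor_def)
      have D: "int (D p p') = (int (\<alpha> p) + int (\<beta> p) + int (\<kappa> p') - int c)^2"
        by (simp add: D_def)
      have exps: "(int (\<alpha> p)^2 + 2 * int (\<alpha> p) * int (\<beta> p) - 2 * int c * int (\<alpha> p))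
          + (int (\<beta> p)^2 + 2 * int (\<beta> p) * int (\<kappa> p') - 2 * int c * int (\<beta> p))
          + (int (\<kappa> p')^2 + 2 * int (\<kappa> p') * int (\<alpha> p) - 2 * int c * int (\<kappa> p') + int c ^ 2)
          = int (D p p')"
        unfolding D by (simp add: power2_eq_square algebra_simps)
      show ?thesis
        unfolding A_def B_def C_def m
        using True by (simp only: m mult_single if_True refl mult_1_right exps ent)
    next
      case False
      then have "entry ?T (\<alpha> p, \<beta> p) (\<beta> p', \<kappa> p') (\<kappa> p'', \<alpha> p'') = 0"
        by (auto simp: to_laurent_def matmul_tensor_def M_def)
      then show ?thesis using False by simp
    qed
    finally show ?thesis .
  qed
  \<comment> \<open>A matching triple carries the indices \<open>\<alpha> p\<close>,
    \<open>\<beta> p\<close>, \<open>\<kappa> p'\<close>. If they sum to \<open>c\<close>, then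
    \<open>\<kappa> p' = \<kappa> p\<close>, and any two indices of a cell determine the third, so
    all three cells coincide.\<close>
  have diag: "p = p' \<and> p' = p'' \<longleftrightarrow> M p p' p'' \<and> D p p' = 0"
    if p: "p < card P" "p' < card P" "p'' < card P" for p p' p''
  proof
    assume "p = p' \<and> p' = p''"
    then show "M p p' p'' \<and> D p p' = 0"
      using gP(4)[OF p(1)] by (auto simp: M_def D_def)
  next
    assume MD: "M p p' p'' \<and> D p p' = 0"
    then have "int (\<alpha> p) + int (\<beta> p) + int (\<kappa> p') = int c" by (auto simp: D_def)
    then have "\<alpha> p + \<beta> p + \<kappa> p' = c" by linarith
    then have "\<alpha> p = \<alpha> p'" "\<beta> p = \<beta> p'" "\<alpha> p = \<alpha> p''" "\<beta> p = \<beta> p''"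
      using MD gP(4)[OF p(1)] gP(4)[OF p(2)] gP(4)[OF p(3)] by (auto simp: M_def)
    then show "p = p' \<and> p' = p''" using inj p by metis
  qed
  have main: "Poly_Mapping.single 0 (if p = p' \<and> p' = p'' then 1 else 0) +
      (\<Sum>q=1..e'. Poly_Mapping.single (int q) (R q p p' p'')) =
      tensor_act A B C (to_laurent (matmul_tensor e h l)) p p' p''"
    if p: "p < card P" "p' < card P" "p'' < card P" for p p' p''
  proof -
    have "(\<Sum>q=1..e'. Poly_Mapping.single (int q) (R q p p' p'')) =
        (\<Sum>q=1..e'. if q = D p p' then (if M p p' p'' then Poly_Mapping.single (int (D p p')) 1 else 0) else 0)"
      by (intro sum.cong refl) (auto simp: R_def)
    also have "\<dots> = (if D p p' \<in> {1..e'} \<and> M p p' p'' then Poly_Mapping.single (int (D p p')) 1 else 0)"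
      by simp
    finally have sum: "(\<Sum>q=1..e'. Poly_Mapping.single (int q) (R q p p' p'')) =
        (if D p p' \<in> {1..e'} \<and> M p p' p'' then Poly_Mapping.single (int (D p p')) 1 else 0)" .
    have "D p p' \<le> (\<Sum>p'<card P. D p p')" using p by (intro member_le_sum) auto
    also have "\<dots> \<le> e'" unfolding e'_def using p by (intro member_le_sum[of p]) auto
    finally have "D p p' \<in> {1..e'} \<longleftrightarrow> D p p' \<noteq> 0" by auto
    then show ?thesis unfolding act[OF p] sum diag[OF p] by auto
  qed
  show ?thesis
    unfolding degenerates_to_def
    by (intro exI[of _ e'] exI[of _ R] exI[of _ A] exI[of _ B] exI[of _ C])
      (use main in \<open>simp add: unit_tensor_def\<close>)
qed

section \<open>Counting the cells of a diagonal band\<close>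

lemma card_triangle:
  fixes a e h :: nat
  assumes "a \<le> e" "a \<le> h"
  shows "2 * card {(i, j). i < e \<and> j < h \<and> i + j < a} = a * (a + 1)"
proof -
  have "{(i, j). i < e \<and> j < h \<and> i + j < a} = Sigma {..<a} (\<lambda>i. {..<a - i})"
    using assms by auto
  then have "card {(i, j). i < e \<and> j < h \<and> i + j < a} = (\<Sum>i<a. a - i)" by simp
  also have "2 * \<dots> = a * (a + 1)"
  proof (induction a)
    case (Suc a)
    have "(\<Sum>i<a. Suc a - i) = (\<Sum>i<a. Suc (a - i))" by (intro sum.cong) auto
    then have "(\<Sum>i<Suc a. Suc a - i) = (\<Sum>i<a. a - i) + a + 1" by (simp add: sum_Suc)
    then show ?case using Suc by simp
  qed simp
  finally show ?thesis .
qed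

text \<open>
  The complement of the diagonal band \<open>a \<le> i + j < a + l\<close> in the rectangle consists of two
  triangles with \<open>a\<close> and \<open>b\<close> diagonals.
\<close>

lemma card_band:
  fixes a b e h l :: nat
  assumes "a \<le> e" "a \<le> h" "b \<le> e" "b \<le> h" "a + b + l = e + h - 1" "1 \<le> e" "1 \<le> h" "1 \<le> l"
  shows "2 * card {(i, j). i < e \<and> j < h \<and> a \<le> i + j \<and> i + j < a + l} + a * (a + 1) + b * (b + 1) = 2 * (e * h)"
proof -
  define P where "P = {(i, j). i < e \<and> j < h \<and> a \<le> i + j \<and> i + j < a + l}"
  define T where "T t = {(i, j). i < e \<and> j < h \<and> i + j < t}" for t :: nat
  define U where "U = {(i, j). i < e \<and> j < h \<and> a + l \<le> i + j}"
  have sub: "P \<subseteq> {..<e} \<times> {..<h}" "T a \<subseteq> {..<e} \<times> {..<h}" "U \<subseteq> {..<e} \<times> {..<h}"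
    by (auto simp: P_def T_def U_def)
  then have fin: "finite P" "finite (T a)" "finite U" by (auto intro: finite_subset)
  \<comment> \<open>Reflection in the centre of the rectangle exchanges the far and the near corner.
    The far one has \<open>b\<close> diagonals because i + j takes e + h - 1 values.\<close>
  have "bij_betw (\<lambda>(i, j). (e - 1 - i, h - 1 - j)) (T b) U"
    by (rule bij_betwI[where g = "\<lambda>(i, j). (e - 1 - i, h - 1 - j)"])
      (use assms in \<open>auto simp: T_def U_def\<close>)
  then have U: "card U = card (T b)" by (simp add: bij_betw_same_card)
  have "P \<union> T a \<union> U = {..<e} \<times> {..<h}" by (auto simp: P_def T_def U_def)
  then have "card (P \<union> T a \<union> U) = e * h" by simp
  moreover have "card (P \<union> T a \<union> U) = card P + card (T a) + card U"
  proof -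
    have "(P \<union> T a) \<inter> U = {}" "P \<inter> T a = {}" by (auto simp: P_def T_def U_def)
    then show ?thesis using fin by (simp add: card_Un_disjoint)
  qed
  ultimately show ?thesis
    using card_triangle[OF assms(1,2)] card_triangle[OF assms(3,4)] U by (simp add: T_def P_def)
qed

text \<open>For e + h > l the band must leave out e + h - l - 1 diagonals. Taking \<open>r\<close>
  of them at one corner and \<open>b\<close> at the other, with \<open>r\<close> equal to
  \<open>b\<close> or \<open>b + 1\<close>, makes the two triangles together have exactly
  \<open>r * (b + 1)\<close> cells.\<close>

lemma matmul_tensor_degenerates_to_unit:
  fixes e h l :: nat
  defines "r \<equiv> (e + h - l) div 2"
  assumes "1 \<le> e" "e \<le> h" "h \<le> l"
  shows "(unit_tensor (e * h - r * (e + h - l - r)) :: (nat, nat, nat, 'a::field) tensor) \<unlhd> matmul_tensor e h l"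
proof -
  let ?P = "{(i, j). i < e \<and> j < h \<and> r \<le> i + j \<and> i + j < r + l}"
  have "card ?P = e * h - r * (e + h - l - r)"
  proof (cases "e + h \<le> l")
    case True
    then have "?P = {..<e} \<times> {..<h}" by (auto simp: r_def)
    then show ?thesis using True by (simp add: r_def card_cartesian_product)
  next
    case False
    define b where "b = e + h - l - 1 - r"
    define s where "s = e + h - l"
    have "1 \<le> s" "r = s div 2" "b = s - 1 - r" using False by (auto simp: s_def r_def b_def)
    then have r: "r = b \<or> r = b + 1" and "s - r = b + 1" by presburger+
    then have s: "e + h - l - r = b + 1" by (simp add: s_def)
    have "2 * card ?P + r * (r + 1) + b * (b + 1) = 2 * (e * h)"
      by (rule card_band) (use assms(2-4) False in \<open>auto simp: r_def b_def\<close>)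
    then show ?thesis unfolding s using r by auto
  qed
  then show ?thesis using unit_tensor_degeneration_matmul[of l e h r, where ?'a = 'a] assms by simp
qed

section \<open>Border subrank and geometric rank of matrix multiplication\<close>

text \<open>Over a finite field the product of all X - a, plus 1, takes only the value 1 and so has
  no root.\<close>

lemma infinite_UNIV_alg_closed_field: "infinite (UNIV :: 'a::alg_closed_field set)"
proof
  assume fin: "finite (UNIV :: 'a set)"
  define p :: "'a poly" where "p = (\<Prod>x\<in>UNIV. [:- x, 1:]) + 1"
  have "degree (\<Prod>x\<in>(UNIV :: 'a set). [:- x, 1:]) = card (UNIV :: 'a set)"
    by (subst degree_prod_eq_sum_degree) auto
  moreover have "card (UNIV :: 'a set) > 0" using fin by (simp add: card_gt_0_iff)
  ultimately have "degree p > 0" unfolding p_def by (subst degree_add_eq_left) auto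
  then obtain z where "poly p z = 0" using alg_closed_imp_poly_has_root by blast
  moreover have "(\<Prod>x\<in>UNIV. z - x) = 0" by (rule prod_zero[OF fin]) auto
  ultimately show False by (simp add: p_def poly_prod)
qed

text \<open>The chain has length \<open>m\<close>, the unit tensor has size \<open>g\<close>, and m
  + g is the dimension of the ambient space. The general bound d + n \<le> m + g then gives n \<le>
  g for d = m and d \<le> m for n = g, which also makes both sets under \<open>Max\<close>
  finite.\<close>

lemma matmul_rank_formula:
  fixes e h l :: nat
  defines "r \<equiv> (e + h - l) div 2"
  assumes "1 \<le> e" "e \<le> h" "h \<le> l"
  shows "border_subrank (matmul_tensor e h l :: 'a::alg_closed_field matmul_tensor) = e * h - r * (e + h - l - r)"
    and "geometric_rank (matmul_tensor e h l :: 'a matmul_tensor) = e * h - r * (e + h - l - r)"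
proof -
  let ?T = "matmul_tensor e h l :: 'a matmul_tensor"
  let ?I = "({..<e} \<times> {..<h}) <+> ({..<h} \<times> {..<l})"
  define g where "g = e * h - r * (e + h - l - r)"
  define m where "m = r * (e + (h - r)) + (h - r) * l"
  have idx: "idx1 ?T = {..<e} \<times> {..<h}" "idx2 ?T = {..<h} \<times> {..<l}" "idx3 ?T = {..<l} \<times> {..<e}"
    by (simp_all add: matmul_tensor_def)
  have card: "card ?I = e * h + h * l" by (simp add: card_Plus)
  have r: "r \<le> e" "r \<le> h" using assms by (auto simp: r_def)
  have sum: "m + g = e * h + h * l"
  proof (cases "e + h \<le> l")
    case True
    then show ?thesis by (simp add: m_def g_def r_def)
  next
    case False
    obtain x where x: "e + h = l + r + x" "x = e + h - l - r"
      using False unfolding r_def by (metis add.assoc add_diff_inverse_nat div_le_dividend not_le le_add_diff_inverse nat_le_linear)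
    obtain y where y: "h = r + y" using r le_Suc_ex by blast
    have "x \<le> h" using x(2) assms(3,4) by linarith
    \<comment> \<open>Shows that the truncated subtraction in \<open>g\<close> is exact.\<close>
    then have le: "r * x \<le> e * h" using r by (intro mult_le_mono)
    have eyl: "e + y = l + x" using x(1) y by simp
    have "m + e * h = r * (l + x) + y * l + e * h"
      using y eyl by (simp add: m_def)
    also have "\<dots> = e * h + h * l + r * x" using y by (simp add: algebra_simps)
    finally show ?thesis using le unfolding g_def x(2)[symmetric] by linarith
  qed
  have deg: "(unit_tensor g :: (nat, nat, nat, 'a) tensor) \<unlhd> ?T"
    unfolding g_def r_def using assms(2-4) by (rule matmul_tensor_degenerates_to_unit)
  obtain Z where "(\<forall>i\<le>m. irreducible_closed ?I (Z i) \<and> Z i \<subseteq> kernel_variety ?T) \<and> (\<forall>i<m. Z i \<subset> Z (Suc i))"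
    using matmul_kernel_chain[OF infinite_UNIV_alg_closed_field[where 'a = 'a] r, of l, folded m_def]
    by (rule exE)
  note Z = conjunct1[OF this] conjunct2[OF this]
  have bound: "d + n \<le> m + g"
    if "(unit_tensor n :: (nat, nat, nat, 'a) tensor) \<unlhd> ?T"
      "\<forall>i\<le>d. irreducible_closed ?I (Z' i) \<and> Z' i \<subseteq> kernel_variety ?T" "\<forall>i<d. Z' i \<subset> Z' (Suc i)" for n d Z'
    using degeneration_chain_bound[OF infinite_UNIV_alg_closed_field that(1), of d Z'] that(2,3)
    by (simp add: idx card sum)
  have "Max {n. (unit_tensor n :: (nat, nat, nat, 'a) tensor) \<unlhd> ?T} = g"
  proof (rule Max_eqI)
    have le: "n \<le> g" if "(unit_tensor n :: (nat, nat, nat, 'a) tensor) \<unlhd> ?T" for n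
      using bound[OF that Z] by simp
    then show "n \<le> g" if "n \<in> {n. (unit_tensor n :: (nat, nat, nat, 'a) tensor) \<unlhd> ?T}" for n
      using that by blast
    show "finite {n. (unit_tensor n :: (nat, nat, nat, 'a) tensor) \<unlhd> ?T}"
      by (rule finite_subset[of _ "{..g}"]) (use le in auto)
  qed (use deg in auto)
  then show "border_subrank ?T = e * h - r * (e + h - l - r)"
    by (simp add: border_subrank_def g_def)
  have "variety_dim ?I (kernel_variety ?T) = m"
    unfolding variety_dim_def
  proof (rule Max_eqI)
    let ?D = "{d. \<exists>Z. (\<forall>i\<le>d. irreducible_closed ?I (Z i) \<and> Z i \<subseteq> kernel_variety ?T) \<and> (\<forall>i<d. Z i \<subset> Z (Suc i))}"
    have le: "d \<le> m" if "d \<in> ?D" for d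
    proof -
      from that obtain Z' where "(\<forall>i\<le>d. irreducible_closed ?I (Z' i) \<and> Z' i \<subseteq> kernel_variety ?T) \<and>
          (\<forall>i<d. Z' i \<subset> Z' (Suc i))"
        unfolding mem_Collect_eq by (rule exE)
      from bound[OF deg conjunct1[OF this] conjunct2[OF this]] show ?thesis by simp
    qed
    then show "d \<le> m" if "d \<in> ?D" for d using that by blast
    show "finite ?D" by (rule finite_subset[of _ "{..m}"]) (use le in auto)
    show "m \<in> ?D" using Z by (intro CollectI exI[of _ Z] conjI)
  qed
  then show "geometric_rank ?T = e * h - r * (e + h - l - r)"
    using sum by (simp add: geometric_rank_def variety_codim_def idx card g_def)
qed

section \<open>Rounding and closed forms\<close>

lemma floor_square_quarter: "\<lfloor>(real s)\<^sup>2 / 4\<rfloor> = int (s div 2 * (s - s div 2))"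
proof -
  define r where "r = s div 2"
  have "s = 2 * r \<or> s = 2 * r + 1" unfolding r_def by presburger
  then show ?thesis
  proof
    assume s: "s = 2 * r"
    then have "(real s)\<^sup>2 / 4 = of_int (int (r * r))" by (simp add: power2_eq_square)
    then have "\<lfloor>(real s)\<^sup>2 / 4\<rfloor> = int (r * r)" by (simp only: floor_of_int)
    then show ?thesis using s by simp
  next
    assume s: "s = 2 * r + 1"
    then have "(real s)\<^sup>2 / 4 = of_int (int (r * (r + 1))) + 1 / 4"
      by (simp add: power2_eq_square field_simps)
    then have "\<lfloor>(real s)\<^sup>2 / 4\<rfloor> = int (r * (r + 1))" by linarith
    then show ?thesis using s by simp
  qed
qed

theorem theorem6p1:
  shows "(\<forall>e h l :: nat. 1 \<le> e \<and> e \<le> h \<and> h \<le> l \<longrightarrow>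
            border_subrank (matmul_tensor e h l :: 'a::alg_closed_field matmul_tensor)
              = geometric_rank (matmul_tensor e h l :: 'a matmul_tensor) \<and>
            int (geometric_rank (matmul_tensor e h l :: 'a matmul_tensor))
              = (if e + h \<ge> l
                 then int (e * h) - \<lfloor>(real e + real h - real l)\<^sup>2 / 4\<rfloor>
                 else int (e * h))) \<and>
         (\<forall>m :: nat. 1 \<le> m \<longrightarrow>
            border_subrank (matmul_tensor m m m :: 'a matmul_tensor)
              = geometric_rank (matmul_tensor m m m :: 'a matmul_tensor) \<and>
            int (geometric_rank (matmul_tensor m m m :: 'a matmul_tensor))
              = \<lceil>3 / 4 * (real m)\<^sup>2\<rceil>)"
proof -
  have main: "border_subrank (matmul_tensor e h l :: 'a matmul_tensor)
      = geometric_rank (matmul_tensor e h l :: 'a matmul_tensor) \<and>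
      int (geometric_rank (matmul_tensor e h l :: 'a matmul_tensor))
      = (if e + h \<ge> l then int (e * h) - \<lfloor>(real e + real h - real l)\<^sup>2 / 4\<rfloor> else int (e * h))"
    if "1 \<le> e" "e \<le> h" "h \<le> l" for e h l
  proof (cases "e + h \<ge> l")
    case True
    define s where "s = e + h - l"
    have "real e + real h - real l = real s" using True by (simp add: s_def of_nat_diff)
    moreover have "s div 2 * (s - s div 2) \<le> e * h"
      using that by (intro mult_le_mono) (auto simp: s_def)
    ultimately show ?thesis
      using True by (simp add: matmul_rank_formula[OF that] floor_square_quarter of_nat_diff flip: s_def)
  next
    case False
    then show ?thesis by (simp add: matmul_rank_formula[OF that])
  qed
  \<comment> \<open>As m^2 is an integer, subtracting a floor from it is the ceiling of the
    difference.\<close>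
  moreover have "int (m * m) - \<lfloor>(real m)\<^sup>2 / 4\<rfloor> = \<lceil>3 / 4 * (real m)\<^sup>2\<rceil>" for m
  proof -
    have "3 / 4 * (real m)\<^sup>2 = of_int (int (m * m)) - (real m)\<^sup>2 / 4"
      by (simp add: power2_eq_square)
    then show ?thesis by linarith
  qed
  ultimately show ?thesis by (metis add_diff_cancel_right' le_add1 le_refl)
qed

end
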